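(* Let $R$ be a reduced Noetherian normal ring. Suppose $D$ is a positive integer that annihilates $\operatorname{Cl}(R_\mathfrak{m})$ for all maximal ideals $\mathfrak{m}$ in $R$. Then for all integers $a > 0$ and all ideals $\mathfrak{q} \subseteq R$ of pure height one, the symbolic power satisfies $\mathfrak{q}^{(Da)} \subseteq \mathfrak{q}^a$.
   Context: All rings are commutative with identity. A ring is normal if its localization at every prime ideal is a normal (integrally closed) domain. For a proper ideal $I$ of a Noetherian ring $R$ and an integer $a>0$, the $a$-th symbolic power is $I^{(a)} := I^a W^{-1}R \cap R$, where $W = R - \bigcup\{P : P \in \operatorname{Ass}_R(R/I)\}$ (the intersection with $R$ means the preimage in $R$). A proper ideal $I$ has pure height $h$ if all of its associated primes (the elements of $\operatorname{Ass}_R(R/I)$) have height $h$; in particular none are embedded. For a Noetherian normal domain $S$, the divisor class group $\operatorname{Cl}(S)$ is the free abelian group on the set of height one prime ideals of $S$ modulo the relations $a_1P_1 + \cdots + a_rP_r = 0$ whenever the ideal $P_1^{(a_1)} \cap \cdots \cap P_r^{(a_r)}$ (with $P_i$ height one primes and $a_i$ positive integers) is principal; this is the usual group of Weil divisors modulo principal divisors. *)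

theory Defs
  imports "HOL-Algebra.Algebra" "HOL-Library.Extended_Nat"
begin

section \<open>Localization\<close>

text \<open>Two fractions are identified when they agree after multiplication by an element of \<open>W\<close>,
  so zero divisors in \<open>W\<close> are allowed. \<open>W\<close> is meant to be a submonoid of \<open>R\<close>.\<close>

definition frac_rel :: "('a, 'b) ring_scheme \<Rightarrow> 'a set \<Rightarrow> (('a \<times> 'a) \<times> ('a \<times> 'a)) set" where
  "frac_rel R W = {((r, s), (r', s')) | r s r' s'.
     r \<in> carrier R \<and> s \<in> W \<and> r' \<in> carrier R \<and> s' \<in> W \<and>
     (\<exists>t\<in>W. t \<otimes>\<^bsub>R\<^esub> (s' \<otimes>\<^bsub>R\<^esub> r \<ominus>\<^bsub>R\<^esub> s \<otimes>\<^bsub>R\<^esub> r') = \<zero>\<^bsub>R\<^esub>)}"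

definition fraction :: "('a, 'b) ring_scheme \<Rightarrow> 'a set \<Rightarrow> 'a \<Rightarrow> 'a \<Rightarrow> ('a \<times> 'a) set" where
  "fraction R W r s = frac_rel R W `` {(r, s)}"

definition localization :: "('a, 'b) ring_scheme \<Rightarrow> 'a set \<Rightarrow> ('a \<times> 'a) set ring" where
  "localization R W =
     \<lparr>carrier = (carrier R \<times> W) // frac_rel R W,
      monoid.mult = (\<lambda>x y. \<Union>(r, s)\<in>x. \<Union>(r', s')\<in>y. fraction R W (r \<otimes>\<^bsub>R\<^esub> r') (s \<otimes>\<^bsub>R\<^esub> s')),
      monoid.one = fraction R W \<one>\<^bsub>R\<^esub> \<one>\<^bsub>R\<^esub>,
      ring.zero = fraction R W \<zero>\<^bsub>R\<^esub> \<one>\<^bsub>R\<^esub>,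
      ring.add = (\<lambda>x y. \<Union>(r, s)\<in>x. \<Union>(r', s')\<in>y.
               fraction R W (r \<otimes>\<^bsub>R\<^esub> s' \<oplus>\<^bsub>R\<^esub> r' \<otimes>\<^bsub>R\<^esub> s) (s \<otimes>\<^bsub>R\<^esub> s'))\<rparr>"

definition loc_map :: "('a, 'b) ring_scheme \<Rightarrow> 'a set \<Rightarrow> 'a \<Rightarrow> ('a \<times> 'a) set" where
  "loc_map R W r = fraction R W r \<one>\<^bsub>R\<^esub>"

definition loc_at :: "('a, 'b) ring_scheme \<Rightarrow> 'a set \<Rightarrow> ('a \<times> 'a) set ring" where
  "loc_at R P = localization R (carrier R - P)"

text \<open>Well-definedness of the operations, and the ring structure.\<close>

context cring
begin

lemma frac_rel_iff:
  "((r, s), (r', s')) \<in> frac_rel R W \<longleftrightarrow>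
     r \<in> carrier R \<and> s \<in> W \<and> r' \<in> carrier R \<and> s' \<in> W \<and>
     (\<exists>t\<in>W. t \<otimes> (s' \<otimes> r \<ominus> s \<otimes> r') = \<zero>)"
  by (auto simp: frac_rel_def)

lemma submonoid_carr: "submonoid W R \<Longrightarrow> s \<in> W \<Longrightarrow> s \<in> carrier R"
  using submonoid.subset by blast

lemma frac_rel_equiv:
  assumes W: "submonoid W R"
  shows "equiv (carrier R \<times> W) (frac_rel R W)"
proof (rule equivI)
  note [simp] = submonoid_carr[OF W] submonoid.m_closed[OF W] submonoid.one_closed[OF W]
  show "frac_rel R W \<subseteq> (carrier R \<times> W) \<times> (carrier R \<times> W)"
    by (auto simp: frac_rel_def)
  show "refl_on (carrier R \<times> W) (frac_rel R W)"
  proof (rule refl_onI)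
    fix x assume "x \<in> carrier R \<times> W"
    then obtain r s where x: "x = (r, s)" "r \<in> carrier R" "s \<in> W" by auto
    have "\<one> \<otimes> (s \<otimes> r \<ominus> s \<otimes> r) = \<zero>"
      using x by (simp add: minus_eq r_neg)
    with x submonoid.one_closed[OF W] show "(x, x) \<in> frac_rel R W"
      unfolding x(1) frac_rel_iff by blast
  qed
  show "sym (frac_rel R W)"
  proof (rule symI)
    fix x y assume xy: "(x, y) \<in> frac_rel R W"
    obtain r s r' s' where e: "x = (r, s)" "y = (r', s')" by (cases x, cases y) auto
    from xy e obtain t where t: "r \<in> carrier R" "s \<in> W" "r' \<in> carrier R" "s' \<in> W" "t \<in> W"
      "t \<otimes> (s' \<otimes> r \<ominus> s \<otimes> r') = \<zero>" by (auto simp: frac_rel_iff)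
    have "t \<otimes> (s \<otimes> r' \<ominus> s' \<otimes> r) = \<ominus> (t \<otimes> (s' \<otimes> r \<ominus> s \<otimes> r'))"
      using t(1-5)[simplified] submonoid_carr[OF W t(2)] submonoid_carr[OF W t(4)] submonoid_carr[OF W t(5)]
      by algebra
    with t have "t \<otimes> (s \<otimes> r' \<ominus> s' \<otimes> r) = \<zero>" by simp
    with t e show "(y, x) \<in> frac_rel R W" by (auto simp: frac_rel_iff)
  qed
  show "trans (frac_rel R W)"
  proof (rule transI)
    fix x y z assume xy: "(x, y) \<in> frac_rel R W" and yz: "(y, z) \<in> frac_rel R W"
    obtain r s r' s' r'' s'' where e: "x = (r, s)" "y = (r', s')" "z = (r'', s'')"
      by (cases x, cases y, cases z) auto
    from xy e obtain t where t: "r \<in> carrier R" "s \<in> W" "r' \<in> carrier R" "s' \<in> W" "t \<in> W"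
      "t \<otimes> (s' \<otimes> r \<ominus> s \<otimes> r') = \<zero>" by (auto simp: frac_rel_iff)
    from yz e obtain u where u: "r'' \<in> carrier R" "s'' \<in> W" "u \<in> W"
      "u \<otimes> (s'' \<otimes> r' \<ominus> s' \<otimes> r'') = \<zero>" by (auto simp: frac_rel_iff)
    have c: "s \<in> carrier R" "s' \<in> carrier R" "s'' \<in> carrier R" "t \<in> carrier R" "u \<in> carrier R"
      using t u by auto
    have "(t \<otimes> u \<otimes> s') \<otimes> (s'' \<otimes> r \<ominus> s \<otimes> r'') =
        (u \<otimes> s'') \<otimes> (t \<otimes> (s' \<otimes> r \<ominus> s \<otimes> r')) \<oplus> (t \<otimes> s) \<otimes> (u \<otimes> (s'' \<otimes> r' \<ominus> s' \<otimes> r''))"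
      using c t(1,3) u(1) by algebra
    also have "\<dots> = \<zero>" using t(6) u(4) c by simp
    finally have "\<exists>v\<in>W. v \<otimes> (s'' \<otimes> r \<ominus> s \<otimes> r'') = \<zero>"
      using t u by (intro bexI[of _ "t \<otimes> u \<otimes> s'"]) auto
    with t u e show "(x, z) \<in> frac_rel R W" by (auto simp: frac_rel_iff)
  qed
qed

lemma frac_eq_iff:
  assumes "submonoid W R" "r \<in> carrier R" "s \<in> W" "r' \<in> carrier R" "s' \<in> W"
  shows "fraction R W r s = fraction R W r' s' \<longleftrightarrow> (\<exists>t\<in>W. t \<otimes> (s' \<otimes> r \<ominus> s \<otimes> r') = \<zero>)"
  using eq_equiv_class_iff[OF frac_rel_equiv[OF assms(1)], of "(r, s)" "(r', s')"] assms
  by (simp add: fraction_def frac_rel_iff)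

lemma frac_eqI:
  assumes "submonoid W R" "r \<in> carrier R" "s \<in> W" "r' \<in> carrier R" "s' \<in> W" "s' \<otimes> r = s \<otimes> r'"
  shows "fraction R W r s = fraction R W r' s'"
  using assms submonoid.one_closed[OF assms(1)] submonoid_carr[OF assms(1)]
  by (subst frac_eq_iff) (auto intro!: bexI[of _ \<one>] simp: minus_eq r_neg)

lemma localization_mult:
  assumes W: "submonoid W R" and "r \<in> carrier R" "s \<in> W" "r' \<in> carrier R" "s' \<in> W"
  shows "fraction R W r s \<otimes>\<^bsub>localization R W\<^esub> fraction R W r' s' = fraction R W (r \<otimes> r') (s \<otimes> s')"
proof -
  let ?f = "\<lambda>p q. case p of (r, s) \<Rightarrow> case q of (r', s') \<Rightarrow> fraction R W (r \<otimes> r') (s \<otimes> s')"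
  have "congruent2 (frac_rel R W) (frac_rel R W) ?f"
  proof (rule congruent2_commuteI[OF frac_rel_equiv[OF W]])
    fix y z assume "y \<in> carrier R \<times> W" "z \<in> carrier R \<times> W"
    then show "?f y z = ?f z y" using submonoid_carr[OF W] by (auto simp: m_comm)
  next
    fix x y z assume xy: "x \<in> carrier R \<times> W" "(y, z) \<in> frac_rel R W"
    obtain a b r s r' s' where e: "x = (a, b)" "y = (r, s)" "z = (r', s')"
      by (cases x, cases y, cases z) auto
    from xy e obtain t where t: "a \<in> carrier R" "b \<in> W" "r \<in> carrier R" "s \<in> W"
      "r' \<in> carrier R" "s' \<in> W" "t \<in> W" "t \<otimes> (s' \<otimes> r \<ominus> s \<otimes> r') = \<zero>"
      by (auto simp: frac_rel_iff)
    have c: "s \<in> carrier R" "s' \<in> carrier R" "t \<in> carrier R" "b \<in> carrier R"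
      using t submonoid_carr[OF W] by auto
    have "t \<otimes> ((b \<otimes> s') \<otimes> (a \<otimes> r) \<ominus> (b \<otimes> s) \<otimes> (a \<otimes> r')) =
       (a \<otimes> b) \<otimes> (t \<otimes> (s' \<otimes> r \<ominus> s \<otimes> r'))" using c t(1,3,5) by algebra
    with t c have "t \<otimes> ((b \<otimes> s') \<otimes> (a \<otimes> r) \<ominus> (b \<otimes> s) \<otimes> (a \<otimes> r')) = \<zero>" by simp
    then show "?f x y = ?f x z"
      using e t W by (auto simp: frac_eq_iff submonoid.m_closed[OF W])
  qed
  from UN_equiv_class2[OF frac_rel_equiv[OF W] frac_rel_equiv[OF W] this, of "(r, s)" "(r', s')"]
  show ?thesis using assms by (simp add: localization_def fraction_def[of R W r s] fraction_def[of R W r' s'] split_def)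
qed

lemma localization_add:
  assumes W: "submonoid W R" and "r \<in> carrier R" "s \<in> W" "r' \<in> carrier R" "s' \<in> W"
  shows "fraction R W r s \<oplus>\<^bsub>localization R W\<^esub> fraction R W r' s' =
           fraction R W (r \<otimes> s' \<oplus> r' \<otimes> s) (s \<otimes> s')"
proof -
  let ?f = "\<lambda>p q. case p of (r, s) \<Rightarrow> case q of (r', s') \<Rightarrow> fraction R W (r \<otimes> s' \<oplus> r' \<otimes> s) (s \<otimes> s')"
  have "congruent2 (frac_rel R W) (frac_rel R W) ?f"
  proof (rule congruent2_commuteI[OF frac_rel_equiv[OF W]])
    fix y z assume "y \<in> carrier R \<times> W" "z \<in> carrier R \<times> W"
    then show "?f y z = ?f z y" using submonoid_carr[OF W] by (auto simp: m_comm a_comm)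
  next
    fix x y z assume xy: "x \<in> carrier R \<times> W" "(y, z) \<in> frac_rel R W"
    obtain a b r s r' s' where e: "x = (a, b)" "y = (r, s)" "z = (r', s')"
      by (cases x, cases y, cases z) auto
    from xy e obtain t where t: "a \<in> carrier R" "b \<in> W" "r \<in> carrier R" "s \<in> W"
      "r' \<in> carrier R" "s' \<in> W" "t \<in> W" "t \<otimes> (s' \<otimes> r \<ominus> s \<otimes> r') = \<zero>"
      by (auto simp: frac_rel_iff)
    have c: "s \<in> carrier R" "s' \<in> carrier R" "t \<in> carrier R" "b \<in> carrier R"
      using t submonoid_carr[OF W] by auto
    have "t \<otimes> ((b \<otimes> s') \<otimes> (a \<otimes> s \<oplus> r \<otimes> b) \<ominus> (b \<otimes> s) \<otimes> (a \<otimes> s' \<oplus> r' \<otimes> b)) =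
       (b \<otimes> b) \<otimes> (t \<otimes> (s' \<otimes> r \<ominus> s \<otimes> r'))" using c t(1,3,5) by algebra
    with t c have "t \<otimes> ((b \<otimes> s') \<otimes> (a \<otimes> s \<oplus> r \<otimes> b) \<ominus> (b \<otimes> s) \<otimes> (a \<otimes> s' \<oplus> r' \<otimes> b)) = \<zero>"
      by simp
    then show "?f x y = ?f x z"
      using e t W c by (auto simp: frac_eq_iff submonoid.m_closed[OF W])
  qed
  from UN_equiv_class2[OF frac_rel_equiv[OF W] frac_rel_equiv[OF W] this, of "(r, s)" "(r', s')"]
  show ?thesis using assms by (simp add: localization_def fraction_def[of R W r s] fraction_def[of R W r' s'] split_def)
qed

lemma localization_carrier:
  "carrier (localization R W) = {fraction R W r s | r s. r \<in> carrier R \<and> s \<in> W}"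
  by (auto simp: localization_def quotient_def fraction_def)

lemma localization_cring:
  assumes W: "submonoid W R"
  shows "cring (localization R W)"
proof -
  note [simp] = submonoid_carr[OF W] submonoid.m_closed[OF W] submonoid.one_closed[OF W]
    localization_mult[OF W] localization_add[OF W]
  have z: "\<zero>\<^bsub>localization R W\<^esub> = fraction R W \<zero> \<one>" "\<one>\<^bsub>localization R W\<^esub> = fraction R W \<one> \<one>"
    by (simp_all add: localization_def)
  let ?L = "localization R W"
  have E: "\<exists>r s. x = fraction R W r s \<and> r \<in> carrier R \<and> s \<in> W" if "x \<in> carrier ?L" for x
    using that by (auto simp: localization_carrier)
  have M: "fraction R W r s \<in> carrier ?L" if "r \<in> carrier R" "s \<in> W" for r s
    using that by (auto simp: localization_carrier)
  show ?thesis
  proof (rule cringI)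
    show "abelian_group ?L"
    proof (rule abelian_groupI)
      fix x y assume "x \<in> carrier ?L" "y \<in> carrier ?L"
      then obtain a b c d where e: "x = fraction R W a b" "a \<in> carrier R" "b \<in> W"
        "y = fraction R W c d" "c \<in> carrier R" "d \<in> W" using E by metis
      show "x \<oplus>\<^bsub>?L\<^esub> y \<in> carrier ?L" using e by (simp add: M)
      show "x \<oplus>\<^bsub>?L\<^esub> y = y \<oplus>\<^bsub>?L\<^esub> x" using e by (simp add: a_comm m_comm)
    next
      show "\<zero>\<^bsub>?L\<^esub> \<in> carrier ?L" by (simp add: z M)
    next
      fix x y w assume "x \<in> carrier ?L" "y \<in> carrier ?L" "w \<in> carrier ?L"
      then obtain a b c d f g where e: "x = fraction R W a b" "a \<in> carrier R" "b \<in> W"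
        "y = fraction R W c d" "c \<in> carrier R" "d \<in> W" "w = fraction R W f g" "f \<in> carrier R" "g \<in> W"
        using E by metis
      have c: "b \<in> carrier R" "d \<in> carrier R" "g \<in> carrier R" using e by auto
      show "x \<oplus>\<^bsub>?L\<^esub> y \<oplus>\<^bsub>?L\<^esub> w = x \<oplus>\<^bsub>?L\<^esub> (y \<oplus>\<^bsub>?L\<^esub> w)"
      proof -
        have "(a \<otimes> d \<oplus> c \<otimes> b) \<otimes> g \<oplus> f \<otimes> (b \<otimes> d) = a \<otimes> (d \<otimes> g) \<oplus> (c \<otimes> g \<oplus> f \<otimes> d) \<otimes> b"
          using e(2,5,8) c by algebra
        then show ?thesis using e by (simp add: m_assoc)
      qed
    next
      fix x assume "x \<in> carrier ?L"
      then obtain a b where e: "x = fraction R W a b" "a \<in> carrier R" "b \<in> W" using E by metis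
      show "\<zero>\<^bsub>?L\<^esub> \<oplus>\<^bsub>?L\<^esub> x = x" using e by (simp add: z)
      have "fraction R W (\<ominus> a) b \<oplus>\<^bsub>?L\<^esub> x = fraction R W \<zero> \<one>"
      proof -
        have "fraction R W (\<ominus> a) b \<oplus>\<^bsub>?L\<^esub> x = fraction R W \<zero> (b \<otimes> b)"
          using e by (simp add: l_minus l_neg)
        also have "\<dots> = fraction R W \<zero> \<one>"
          by (rule frac_eqI[OF W]) (use e in simp_all)
        finally show ?thesis .
      qed
      then show "\<exists>y\<in>carrier ?L. y \<oplus>\<^bsub>?L\<^esub> x = \<zero>\<^bsub>?L\<^esub>"
        using e M z by (metis a_inv_closed)
    qed
  next
    show "comm_monoid ?L"
    proof (rule comm_monoidI)
      fix x y assume "x \<in> carrier ?L" "y \<in> carrier ?L"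
      then obtain a b c d where e: "x = fraction R W a b" "a \<in> carrier R" "b \<in> W"
        "y = fraction R W c d" "c \<in> carrier R" "d \<in> W" using E by metis
      show "x \<otimes>\<^bsub>?L\<^esub> y \<in> carrier ?L" using e by (simp add: M)
      show "x \<otimes>\<^bsub>?L\<^esub> y = y \<otimes>\<^bsub>?L\<^esub> x" using e by (simp add: m_comm)
    next
      show "\<one>\<^bsub>?L\<^esub> \<in> carrier ?L" by (simp add: z M)
    next
      fix x y w assume "x \<in> carrier ?L" "y \<in> carrier ?L" "w \<in> carrier ?L"
      then obtain a b c d f g where e: "x = fraction R W a b" "a \<in> carrier R" "b \<in> W"
        "y = fraction R W c d" "c \<in> carrier R" "d \<in> W" "w = fraction R W f g" "f \<in> carrier R" "g \<in> W"
        using E by metis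
      then show "x \<otimes>\<^bsub>?L\<^esub> y \<otimes>\<^bsub>?L\<^esub> w = x \<otimes>\<^bsub>?L\<^esub> (y \<otimes>\<^bsub>?L\<^esub> w)" by (simp add: m_assoc)
    next
      fix x assume "x \<in> carrier ?L"
      then obtain a b where e: "x = fraction R W a b" "a \<in> carrier R" "b \<in> W" using E by metis
      then show "\<one>\<^bsub>?L\<^esub> \<otimes>\<^bsub>?L\<^esub> x = x" by (simp add: z)
    qed
  next
    fix x y w assume "x \<in> carrier ?L" "y \<in> carrier ?L" "w \<in> carrier ?L"
    then obtain a b c d f g where e: "x = fraction R W a b" "a \<in> carrier R" "b \<in> W"
      "y = fraction R W c d" "c \<in> carrier R" "d \<in> W" "w = fraction R W f g" "f \<in> carrier R" "g \<in> W"
      using E by metis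
    have c: "b \<in> carrier R" "d \<in> carrier R" "g \<in> carrier R" using e by auto
    have "(b \<otimes> g \<otimes> (d \<otimes> g)) \<otimes> ((a \<otimes> d \<oplus> c \<otimes> b) \<otimes> f) =
        (b \<otimes> d \<otimes> g) \<otimes> (a \<otimes> f \<otimes> (d \<otimes> g) \<oplus> c \<otimes> f \<otimes> (b \<otimes> g))"
      using e(2,5,8) c by algebra
    then show "(x \<oplus>\<^bsub>?L\<^esub> y) \<otimes>\<^bsub>?L\<^esub> w = x \<otimes>\<^bsub>?L\<^esub> w \<oplus>\<^bsub>?L\<^esub> y \<otimes>\<^bsub>?L\<^esub> w"
      using e by (simp, intro frac_eqI[OF W]) simp_all
  qed
qed

lemma loc_map_hom:
  assumes W: "submonoid W R"
  shows "loc_map R W \<in> ring_hom R (localization R W)"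
proof (rule ring_hom_memI)
  fix x y assume "x \<in> carrier R" "y \<in> carrier R"
  then show "loc_map R W (x \<otimes> y) = loc_map R W x \<otimes>\<^bsub>localization R W\<^esub> loc_map R W y"
    and "loc_map R W (x \<oplus> y) = loc_map R W x \<oplus>\<^bsub>localization R W\<^esub> loc_map R W y"
    using W by (simp_all add: loc_map_def localization_mult localization_add submonoid.one_closed)
next
  show "loc_map R W \<one> = \<one>\<^bsub>localization R W\<^esub>" by (simp add: loc_map_def localization_def)
next
  fix x assume "x \<in> carrier R"
  then show "loc_map R W x \<in> carrier (localization R W)"
    using submonoid.one_closed[OF W] by (auto simp: loc_map_def localization_carrier)
qed

end

section \<open>Reduced and normal rings\<close>

definition reduced_ring :: "('a, 'b) ring_scheme \<Rightarrow> bool" where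
  "reduced_ring R \<longleftrightarrow>
     (\<forall>x\<in>carrier R. \<forall>n::nat. x [^]\<^bsub>R\<^esub> n = \<zero>\<^bsub>R\<^esub> \<longrightarrow> x = \<zero>\<^bsub>R\<^esub>)"

text \<open>\<open>x\<close> is a root of a monic polynomial with coefficients in the subring \<open>A\<close> of \<open>K\<close>.
  Polynomials are coefficient lists with the leading coefficient first.\<close>

definition integral_over :: "('a, 'b) ring_scheme \<Rightarrow> 'a set \<Rightarrow> 'a \<Rightarrow> bool" where
  "integral_over K A x \<longleftrightarrow>
     (\<exists>p. p \<noteq> [] \<and> polynomial\<^bsub>K\<^esub> A p \<and> lead_coeff p = \<one>\<^bsub>K\<^esub> \<and> ring.eval K p x = \<zero>\<^bsub>K\<^esub>)"

text \<open>An integrally closed domain; the localization below is its fraction field.\<close>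

definition normal_domain :: "('a, 'b) ring_scheme \<Rightarrow> bool" where
  "normal_domain A \<longleftrightarrow> domain A \<and>
     (let W = carrier A - {\<zero>\<^bsub>A\<^esub>}; K = localization A W; A' = loc_map A W ` carrier A
      in \<forall>x\<in>carrier K. integral_over K A' x \<longrightarrow> x \<in> A')"

definition normal_ring :: "('a, 'b) ring_scheme \<Rightarrow> bool" where
  "normal_ring R \<longleftrightarrow> (\<forall>P. primeideal P R \<longrightarrow> normal_domain (loc_at R P))"

section \<open>Symbolic powers and pure height\<close>

text \<open>The associated primes of the \<open>R\<close>-module \<open>R/I\<close>: prime ideals that are annihilators of
  an element of \<open>R/I\<close>, where \<open>r\<close> acts as its residue class.\<close>

definition Ass_quot :: "('a, 'b) ring_scheme \<Rightarrow> 'a set \<Rightarrow> 'a set set" where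
  "Ass_quot R I = {P. primeideal P R \<and>
     (\<exists>\<xi>\<in>carrier (R Quot I).
        P = {r \<in> carrier R. (I +>\<^bsub>R\<^esub> r) \<otimes>\<^bsub>R Quot I\<^esub> \<xi> = \<zero>\<^bsub>R Quot I\<^esub>})}"

abbreviation ideal_power :: "('a, 'b) ring_scheme \<Rightarrow> 'a set \<Rightarrow> nat \<Rightarrow> 'a set" where
  "ideal_power R I n \<equiv> I [^]\<^bsub>ideals_set R\<^esub> n"

definition symbolic_power :: "('a, 'b) ring_scheme \<Rightarrow> 'a set \<Rightarrow> nat \<Rightarrow> 'a set" where
  "symbolic_power R I n =
     (let W = carrier R - \<Union> (Ass_quot R I)
      in {r \<in> carrier R. loc_map R W r \<in>
            Idl\<^bsub>localization R W\<^esub> (loc_map R W ` ideal_power R I n)})"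

definition height :: "('a, 'b) ring_scheme \<Rightarrow> 'a set \<Rightarrow> enat" where
  "height R P = Sup {enat n | n. \<exists>p::nat \<Rightarrow> 'a set.
     (\<forall>i\<le>n. primeideal (p i) R) \<and> (\<forall>i<n. p i \<subset> p (Suc i)) \<and> p n = P}"

definition pure_height :: "('a, 'b) ring_scheme \<Rightarrow> 'a set \<Rightarrow> enat \<Rightarrow> bool" where
  "pure_height R I h \<longleftrightarrow>
     ideal I R \<and> I \<noteq> carrier R \<and> (\<forall>P\<in>Ass_quot R I. height R P = h)"

section \<open>The divisor class group\<close>

definition height_one_primes :: "('a, 'b) ring_scheme \<Rightarrow> 'a set set" where
  "height_one_primes S = {P. primeideal P S \<and> height S P = 1}"

text \<open>The formal sums with positive coefficients whose intersection of symbolic powers is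
  principal. The intersection with the carrier only matters for the zero sum, where it yields
  the unit ideal.\<close>

definition principal_divisors :: "('a, 'b) ring_scheme \<Rightarrow> ('a set \<Rightarrow>\<^sub>0 int) set" where
  "principal_divisors S =
     {c. Poly_Mapping.keys c \<subseteq> height_one_primes S \<and>
         (\<forall>P\<in>Poly_Mapping.keys c. Poly_Mapping.lookup c P > 0) \<and>
         principalideal
           (carrier S \<inter> (\<Inter>P\<in>Poly_Mapping.keys c.
              symbolic_power S P (nat (Poly_Mapping.lookup c P)))) S}"

text \<open>Written multiplicatively, as is the library's free abelian group.\<close>

definition class_group :: "('a, 'b) ring_scheme \<Rightarrow> ('a set \<Rightarrow>\<^sub>0 int) set monoid" where
  "class_group S =
     (let F = free_Abelian_group (height_one_primes S)
      in F Mod generate F (principal_divisors S))"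

end

theory Submission
  imports Defs
begin

text \<open>Everything is checked locally at a maximal ideal. There \<open>R\<close> becomes a Noetherian normal domain
  \<open>S\<close>, whose localizations at height one primes are discrete valuation rings, and \<open>q\<close> becomes an
  ideal \<open>I\<close> with minimal value \<open>n\<^sub>P\<close> at \<open>P\<close>. Since \<open>D\<close> kills the class group,
  the divisor \<open>\<Sum> D n\<^sub>P P\<close> is the divisor of a single element \<open>h\<close> of \<open>S\<close>.
  Membership in \<open>I\<close>, and in a principal ideal, can be tested at the associated primes, all of
  height one; so \<open>h \<in> I\<close> because \<open>D n\<^sub>P \<ge> n\<^sub>P\<close>, while \<open>h ^ a\<close> divides every element of
  the symbolic power of exponent \<open>D a\<close>.\<close>

section \<open>Colon ideals, saturations and extensions\<close>

text \<open>Values alone do not test membership in \<open>I ^ a\<close>, since powers can acquire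
  embedded components. The principal ideal of \<open>h ^ a\<close> avoids this: it lies in
  \<open>I ^ a\<close> because \<open>h\<close> lies in \<open>I\<close>, and in a normal domain its
  associated primes all have height one, so values decide what it contains. The class group only
  supplies a quotient \<open>f / g\<close> with values \<open>D n\<^sub>P\<close>; it is an element
  \<open>h\<close> of \<open>S\<close> because these are nonnegative. The valuation rings are never
  formed: divisibility at \<open>P\<close> is expressed inside \<open>S\<close> by multipliers
  outside \<open>P\<close>. Since \<open>R\<close> need not be a domain, the map to \<open>S\<close>
  may have a kernel, and two facts must be carried over: the associated primes of \<open>I\<close>
  have height one, and \<open>I\<close> is not zero. The first uses that they contract to associated
  primes of \<open>q\<close>; the second that the kernel lies in every prime surviving in
  \<open>S\<close>, whereas an associated prime of \<open>q\<close> has a smaller prime below it.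
  The multiplier that puts an element into the symbolic power avoids the associated primes of
  \<open>q\<close>, so it is harmless at each height one prime containing \<open>I\<close>.\<close>

lemma (in noetherian_ring) exists_maximal_ideal_in:
  assumes "C \<noteq> {}" "\<And>I. I \<in> C \<Longrightarrow> ideal I R"
  obtains M where "M \<in> C" "\<And>I. I \<in> C \<Longrightarrow> M \<subseteq> I \<Longrightarrow> I = M"
proof -
  have "\<exists>M\<in>C. \<forall>I\<in>C. M \<subseteq> I \<longrightarrow> I = M"
  proof (rule subset_Zorn)
    fix K assume K: "subset.chain C K"
    show "\<exists>U\<in>C. \<forall>I\<in>K. I \<subseteq> U"
    proof (cases "K = {}")
      case True
      then show ?thesis using assms(1) by auto
    next
      case False
      have "subset.chain {I. ideal I R} K"
        using K assms(2) unfolding pred_on.chain_def by auto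
      from ideal_chain_is_trivial[OF False this] K show ?thesis
        unfolding pred_on.chain_def by (metis Union_upper subsetD)
    qed
  qed
  then show ?thesis using that by blast
qed

definition colon :: "('a, 'b) ring_scheme \<Rightarrow> 'a set \<Rightarrow> 'a \<Rightarrow> 'a set" where
  "colon R I s = {r \<in> carrier R. r \<otimes>\<^bsub>R\<^esub> s \<in> I}"

text \<open>The contraction of the extension of \<open>I\<close> to the localization at the prime \<open>P\<close>.\<close>

definition saturation :: "('a, 'b) ring_scheme \<Rightarrow> 'a set \<Rightarrow> 'a set \<Rightarrow> 'a set" where
  "saturation R P I = {r \<in> carrier R. \<exists>u \<in> carrier R - P. u \<otimes>\<^bsub>R\<^esub> r \<in> I}"

text \<open>The extended ideal written out: common denominators make the fractions with numerator in
  \<open>J\<close> an ideal, and \<open>Idl_loc_map_image\<close> identifies it with the ideal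
  generated by the image of \<open>J\<close>.\<close>

definition extension :: "('a, 'b) ring_scheme \<Rightarrow> 'a set \<Rightarrow> 'a set \<Rightarrow> ('a \<times> 'a) set set" where
  "extension R W J = {fraction R W r s | r s. r \<in> J \<and> s \<in> W}"

context cring
begin

lemma cring_idealI:
  assumes "I \<subseteq> carrier R" "\<zero> \<in> I" "\<And>x y. x \<in> I \<Longrightarrow> y \<in> I \<Longrightarrow> x \<oplus> y \<in> I"
    and "\<And>a x. a \<in> carrier R \<Longrightarrow> x \<in> I \<Longrightarrow> a \<otimes> x \<in> I"
  shows "ideal I R"
proof (rule idealI)
  show "ring R" by (rule ring_axioms)
  show "subgroup I (add_monoid R)"
  proof (rule add.subgroupI)
    show "I \<subseteq> carrier R" "I \<noteq> {}" using assms by auto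
    show "\<ominus> a \<in> I" if "a \<in> I" for a
      using assms(4)[of "\<ominus> \<one>" a] that assms(1) by (auto simp: l_minus)
  qed (use assms in auto)
  fix a x assume ax: "a \<in> I" "x \<in> carrier R"
  then show "x \<otimes> a \<in> I" by (rule assms(4)[rotated])
  then show "a \<otimes> x \<in> I" using ax assms(1) by (simp add: m_comm subsetD)
qed

lemma colon_ideal:
  assumes "ideal I R" "s \<in> carrier R"
  shows "ideal (colon R I s) R"
proof -
  interpret ideal I R by fact
  show ?thesis
    by (rule cring_idealI) (use assms(2) in \<open>auto simp: colon_def l_distr m_assoc I_l_closed\<close>)
qed

lemma colon_mono_mult:
  assumes "ideal I R" "s \<in> carrier R" "t \<in> carrier R"
  shows "colon R I s \<subseteq> colon R I (s \<otimes> t)"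
  using assms ideal.I_r_closed[OF assms(1)] by (auto simp: colon_def m_assoc[symmetric])

lemma colon_superset:
  assumes "ideal I R" "s \<in> carrier R"
  shows "I \<subseteq> colon R I s"
  using assms ideal.I_r_closed[OF assms(1)] ideal.Icarr by (fastforce simp: colon_def)

lemma primeideal_one_notin: "primeideal P R \<Longrightarrow> \<one> \<notin> P"
  using ideal.one_imp_carrier[of P R] primeideal.I_notcarr[of P R] primeideal.axioms(1) by blast

lemma primeideal_mult_notin:
  "primeideal P R \<Longrightarrow> u \<in> carrier R - P \<Longrightarrow> v \<in> carrier R - P \<Longrightarrow> u \<otimes> v \<in> carrier R - P"
  using primeideal.I_prime[of P R u v] by auto

lemma primeideal_pow_notin:
  "primeideal P R \<Longrightarrow> u \<in> carrier R - P \<Longrightarrow> u [^] (n::nat) \<in> carrier R - P"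
  by (induction n) (use primeideal_one_notin primeideal_mult_notin in auto)

lemma submonoid_compl_primes:
  assumes "\<And>P. P \<in> Q \<Longrightarrow> primeideal P R"
  shows "submonoid (carrier R - \<Union> Q) R"
proof
  show "\<one> \<in> carrier R - \<Union> Q" using assms primeideal_one_notin by auto
  fix x y assume "x \<in> carrier R - \<Union> Q" "y \<in> carrier R - \<Union> Q"
  then show "x \<otimes> y \<in> carrier R - \<Union> Q" using primeideal_mult_notin[OF assms] by blast
qed auto

lemma submonoid_compl_prime: "primeideal P R \<Longrightarrow> submonoid (carrier R - P) R"
  using submonoid_compl_primes[of "{P}"] by simp

lemma saturation_ideal:
  assumes "primeideal P R" "ideal I R"
  shows "ideal (saturation R P I) R"
proof -
  interpret I: ideal I R by fact
  note mult = primeideal_mult_notin[OF assms(1)]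
  show ?thesis
  proof (rule cring_idealI)
    show "\<zero> \<in> saturation R P I"
      using primeideal_one_notin[OF assms(1)] by (auto simp: saturation_def intro!: bexI[of _ \<one>])
    fix x y assume "x \<in> saturation R P I" "y \<in> saturation R P I"
    then obtain u v where uv: "u \<in> carrier R - P" "v \<in> carrier R - P" "u \<otimes> x \<in> I" "v \<otimes> y \<in> I"
      "x \<in> carrier R" "y \<in> carrier R" by (auto simp: saturation_def)
    have "u \<otimes> v \<otimes> (x \<oplus> y) = v \<otimes> (u \<otimes> x) \<oplus> u \<otimes> (v \<otimes> y)"
      using uv(5,6) DiffD1[OF uv(1)] DiffD1[OF uv(2)] by algebra
    also have "\<dots> \<in> I" using uv by (auto intro: I.I_l_closed)
    finally show "x \<oplus> y \<in> saturation R P I"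
      using mult[OF uv(1,2)] uv by (auto simp: saturation_def)
  next
    fix a x assume "a \<in> carrier R" "x \<in> saturation R P I"
    then obtain u where u: "u \<in> carrier R - P" "u \<otimes> x \<in> I" "x \<in> carrier R" "a \<in> carrier R"
      by (auto simp: saturation_def)
    then have "u \<otimes> (a \<otimes> x) \<in> I" using I.I_l_closed[OF u(2,4)] by (simp add: m_lcomm)
    with u show "a \<otimes> x \<in> saturation R P I" by (auto simp: saturation_def)
  qed (auto simp: saturation_def)
qed

lemma saturation_mono: "I \<subseteq> J \<Longrightarrow> saturation R P I \<subseteq> saturation R P J"
  by (auto simp: saturation_def)

lemma subset_saturation:
  assumes "primeideal P R" "I \<subseteq> carrier R"
  shows "I \<subseteq> saturation R P I"
  using primeideal_one_notin[OF assms(1)] assms(2)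
  by (auto simp: saturation_def intro!: bexI[of _ \<one>])

lemma saturation_subset_prime:
  assumes "primeideal P R" "primeideal Q R" "Q \<subseteq> P"
  shows "saturation R P Q = Q"
proof
  show "Q \<subseteq> saturation R P Q"
    using subset_saturation[OF assms(1)] ideal.Icarr[OF primeideal.axioms(1)[OF assms(2)]] by blast
  show "saturation R P Q \<subseteq> Q"
    using primeideal.I_prime[OF assms(2)] assms(3) by (fastforce simp: saturation_def)
qed

lemma mem_saturation_PIdl:
  assumes "y \<in> carrier R"
  shows "x \<in> saturation R P (PIdl y) \<longleftrightarrow>
    x \<in> carrier R \<and> (\<exists>u\<in>carrier R - P. \<exists>c\<in>carrier R. u \<otimes> x = c \<otimes> y)"
  by (auto simp: saturation_def cgenideal_def)

lemma mem_saturation_saturation: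
  assumes "primeideal P R" "x \<in> carrier R" "u \<in> carrier R - P" "u \<otimes> x \<in> saturation R P I"
  shows "x \<in> saturation R P I"
proof -
  from assms(4) obtain v where "v \<in> carrier R - P" "v \<otimes> (u \<otimes> x) \<in> I" by (auto simp: saturation_def)
  with assms(2,3) primeideal_mult_notin[OF assms(1) this(1) assms(3)] show ?thesis
    by (auto simp: saturation_def m_assoc intro!: bexI[of _ "v \<otimes> u"])
qed

lemma saturation_subset_saturation:
  assumes "primeideal P R" "I \<subseteq> saturation R P J"
  shows "saturation R P I \<subseteq> saturation R P J"
proof
  fix x assume "x \<in> saturation R P I"
  then obtain u where "x \<in> carrier R" "u \<in> carrier R - P" "u \<otimes> x \<in> I"
    by (auto simp: saturation_def)
  with assms(2) show "x \<in> saturation R P J"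
    using mem_saturation_saturation[OF assms(1)] by blast
qed

text \<open>Every element of R/I is the coset of some \<open>t\<close>, and its annihilator is
  \<open>colon R I t\<close>. Associated primes are handled in this form from here on.\<close>

lemma Ass_quot_iff:
  assumes I: "ideal I R"
  shows "P \<in> Ass_quot R I \<longleftrightarrow> primeideal P R \<and> (\<exists>t\<in>carrier R. P = colon R I t)"
proof -
  interpret I: ideal I R by fact
  have "(I +> r) \<otimes>\<^bsub>R Quot I\<^esub> (I +> t) = \<zero>\<^bsub>R Quot I\<^esub> \<longleftrightarrow> r \<otimes> t \<in> I"
    if "r \<in> carrier R" "t \<in> carrier R" for r t
    using that I.rcoset_mult_add[of r t] I.a_rcos_const[of "r \<otimes> t"] I.a_rcos_self[of "r \<otimes> t"]
    by (auto simp: FactRing_def)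
  then have "{r \<in> carrier R. (I +> r) \<otimes>\<^bsub>R Quot I\<^esub> (I +> t) = \<zero>\<^bsub>R Quot I\<^esub>} = colon R I t"
    if "t \<in> carrier R" for t
    using that by (auto simp: colon_def)
  then show ?thesis
    by (auto simp: Ass_quot_def FactRing_def A_RCOSETS_def' )
qed

section \<open>Ideals of a localization\<close>

lemma frac_expand:
  assumes "submonoid W R" "r \<in> carrier R" "s \<in> W" "w \<in> W"
  shows "fraction R W r s = fraction R W (w \<otimes> r) (w \<otimes> s)"
  using assms submonoid.m_closed[OF assms(1)] submonoid_carr[OF assms(1)]
  by (intro frac_eqI) (auto simp: m_ac)

lemma extension_ideal:
  assumes W: "submonoid W R" and J: "ideal J R"
  shows "ideal (extension R W J) (localization R W)"
proof -
  interpret L: cring "localization R W" by (rule localization_cring[OF W])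
  interpret J: ideal J R by fact
  note [simp] = submonoid_carr[OF W] submonoid.m_closed[OF W] submonoid.one_closed[OF W]
    localization_mult[OF W] localization_add[OF W] localization_carrier J.I_l_closed J.I_r_closed
  show ?thesis
  proof (rule L.cring_idealI)
    show "extension R W J \<subseteq> carrier (localization R W)"
      using J.Icarr unfolding extension_def localization_carrier by blast
    show "\<zero>\<^bsub>localization R W\<^esub> \<in> extension R W J"
    proof -
      have "\<zero>\<^bsub>localization R W\<^esub> = fraction R W \<zero> \<one>" by (simp add: localization_def)
      then show ?thesis unfolding extension_def using submonoid.one_closed[OF W] J.zero_closed by blast
    qed
    fix x y assume "x \<in> extension R W J" "y \<in> extension R W J"
    then obtain a b c d where e: "x = fraction R W a b" "a \<in> J" "b \<in> W"
        "y = fraction R W c d" "c \<in> J" "d \<in> W" by (auto simp: extension_def)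
    then have "a \<otimes> d \<oplus> c \<otimes> b \<in> J" "b \<otimes> d \<in> W"
      "x \<oplus>\<^bsub>localization R W\<^esub> y = fraction R W (a \<otimes> d \<oplus> c \<otimes> b) (b \<otimes> d)" by simp_all
    then show "x \<oplus>\<^bsub>localization R W\<^esub> y \<in> extension R W J"
      unfolding extension_def by blast
  next
    fix x y assume "x \<in> carrier (localization R W)" "y \<in> extension R W J"
    then obtain a b c d where e: "x = fraction R W a b" "a \<in> carrier R" "b \<in> W"
        "y = fraction R W c d" "c \<in> J" "d \<in> W" by (auto simp: extension_def)
    then have "a \<otimes> c \<in> J" "b \<otimes> d \<in> W"
      "x \<otimes>\<^bsub>localization R W\<^esub> y = fraction R W (a \<otimes> c) (b \<otimes> d)" by simp_all
    then show "x \<otimes>\<^bsub>localization R W\<^esub> y \<in> extension R W J"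
      unfolding extension_def by blast
  qed
qed

text \<open>A fraction in the extended ideal may be written with a numerator outside
  \<open>J\<close>, so membership is a condition up to a multiplier in \<open>W\<close>. If it
  equals \<open>r' / s'\<close> with \<open>r'\<close> in \<open>J\<close> and \<open>t\<close>
  witnesses the equality, the multiplier is \<open>t \<otimes> s'\<close>.\<close>

lemma fraction_mem_extension:
  assumes W: "submonoid W R" and J: "ideal J R" and r: "r \<in> carrier R" "s \<in> W"
  shows "fraction R W r s \<in> extension R W J \<longleftrightarrow> (\<exists>w\<in>W. w \<otimes> r \<in> J)"
proof
  interpret J: ideal J R by fact
  note [simp] = submonoid_carr[OF W] submonoid.m_closed[OF W]
  assume "fraction R W r s \<in> extension R W J"
  then obtain r' s' where rs: "r' \<in> J" "s' \<in> W" "fraction R W r s = fraction R W r' s'"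
    by (auto simp: extension_def)
  then obtain t where t: "t \<in> W" "t \<otimes> (s' \<otimes> r \<ominus> s \<otimes> r') = \<zero>"
    using frac_eq_iff[OF W r] by auto
  have c: "t \<in> carrier R" "s' \<in> carrier R" "s \<in> carrier R" "r' \<in> carrier R"
    using t rs r by auto
  have "t \<otimes> s' \<otimes> r = t \<otimes> (s' \<otimes> r \<ominus> s \<otimes> r') \<oplus> (t \<otimes> s) \<otimes> r'"
    using c r(1) by algebra
  also have "\<dots> \<in> J" using t(2) c rs(1) by (simp add: J.I_l_closed)
  finally show "\<exists>w\<in>W. w \<otimes> r \<in> J" using t(1) rs(2) by auto
next
  assume "\<exists>w\<in>W. w \<otimes> r \<in> J"
  then obtain w where w: "w \<in> W" "w \<otimes> r \<in> J" by blast
  then show "fraction R W r s \<in> extension R W J"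
    using frac_expand[OF W r w(1)] submonoid.m_closed[OF W w(1) r(2)] by (auto simp: extension_def)
qed

lemma Idl_loc_map_image:
  assumes W: "submonoid W R" and J: "ideal J R"
  shows "Idl\<^bsub>localization R W\<^esub> (loc_map R W ` J) = extension R W J"
proof
  interpret L: cring "localization R W" by (rule localization_cring[OF W])
  interpret J: ideal J R by fact
  note [simp] = submonoid_carr[OF W] submonoid.m_closed[OF W] submonoid.one_closed[OF W]
  have sub: "loc_map R W ` J \<subseteq> extension R W J"
    unfolding extension_def loc_map_def using submonoid.one_closed[OF W] by blast
  then show "Idl\<^bsub>localization R W\<^esub> (loc_map R W ` J) \<subseteq> extension R W J"
    by (intro L.genideal_minimal extension_ideal[OF W J])
  have sub': "loc_map R W ` J \<subseteq> carrier (localization R W)"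
    using loc_map_hom[OF W] by (auto simp: ring_hom_closed)
  interpret I: ideal "Idl\<^bsub>localization R W\<^esub> (loc_map R W ` J)" "localization R W"
    by (rule L.genideal_ideal[OF sub'])
  show "extension R W J \<subseteq> Idl\<^bsub>localization R W\<^esub> (loc_map R W ` J)"
  proof
    fix x assume "x \<in> extension R W J"
    then obtain r s where x: "x = fraction R W r s" "r \<in> J" "s \<in> W" by (auto simp: extension_def)
    then have "x = fraction R W \<one> s \<otimes>\<^bsub>localization R W\<^esub> loc_map R W r"
      by (simp add: localization_mult[OF W] loc_map_def)
    also have "\<dots> \<in> Idl\<^bsub>localization R W\<^esub> (loc_map R W ` J)"
      using x L.genideal_self[OF sub'] by (intro I.I_l_closed) (auto simp: localization_carrier)
    finally show "x \<in> Idl\<^bsub>localization R W\<^esub> (loc_map R W ` J)" .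
  qed
qed

section \<open>Ideal powers and symbolic powers\<close>

lemma ideal_power_ideal: "ideal I R \<Longrightarrow> ideal (ideal_power R I n) R"
proof -
  interpret M: comm_monoid "ideals_set R" by (rule ideals_set_is_comm_monoid)
  show "ideal I R \<Longrightarrow> ideal (ideal_power R I n) R"
    using M.nat_pow_closed[of I n] by (simp add: ideals_set_def)
qed

lemma ideal_power_0: "ideal_power R I 0 = carrier R"
  by (simp add: ideals_set_def nat_pow_def)

lemma ideal_power_Suc: "ideal_power R I (Suc n) = ideal_prod R (ideal_power R I n) I"
  by (simp add: ideals_set_def nat_pow_def)

lemma pow_mem_ideal_power:
  assumes "ideal I R" "x \<in> I" shows "x [^] n \<in> ideal_power R I n"
proof (induction n)
  case 0
  show ?case unfolding ideal_power_0 by simp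
next
  case (Suc n)
  show ?case unfolding ideal_power_Suc using ideal_prod.prod[OF Suc assms(2)] by simp
qed

lemma symbolic_power_eq:
  assumes "ideal I R"
  shows "symbolic_power R I n =
    {r \<in> carrier R. \<exists>w\<in>carrier R - \<Union> (Ass_quot R I). w \<otimes> r \<in> ideal_power R I n}"
proof -
  have W: "submonoid (carrier R - \<Union> (Ass_quot R I)) R"
    by (rule submonoid_compl_primes) (simp add: Ass_quot_def)
  note J = ideal_power_ideal[OF assms]
  have "loc_map R W r \<in> Idl\<^bsub>localization R W\<^esub> (loc_map R W ` ideal_power R I n)
      \<longleftrightarrow> (\<exists>w\<in>W. w \<otimes> r \<in> ideal_power R I n)"
    if "r \<in> carrier R" "W = carrier R - \<Union> (Ass_quot R I)" for r W
    using fraction_mem_extension[OF W J that(1)] submonoid.one_closed[OF W] that(2)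
    unfolding that(2) Idl_loc_map_image[OF W J] by (simp only: loc_map_def)
  then show ?thesis by (auto simp: symbolic_power_def Let_def)
qed

text \<open>R/P is a domain, so each of its nonzero elements has annihilator \<open>P\<close>, while
  the zero element has the whole ring, which is not prime.\<close>

lemma Ass_quot_prime:
  assumes "primeideal P R"
  shows "Ass_quot R P = {P}"
proof -
  interpret primeideal P R by fact
  have "colon R P t = (if t \<in> P then carrier R else P)" if "t \<in> carrier R" for t
    using that I_prime I_l_closed I_r_closed Icarr by (auto simp: colon_def)
  then show ?thesis
    using assms I_notcarr primeideal_one_notin[OF assms] Ass_quot_iff[OF is_ideal]
    by (auto split: if_splits intro!: bexI[of _ \<one>] dest: primeideal.I_notcarr)
qed

lemma symbolic_power_prime:
  assumes "primeideal P R"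
  shows "symbolic_power R P n = saturation R P (ideal_power R P n)"
  using symbolic_power_eq[OF primeideal.axioms(1)[OF assms]] Ass_quot_prime[OF assms]
  by (simp add: saturation_def)

section \<open>Height one in terms of chains of primes\<close>

lemma height_geI:
  assumes "\<And>i. i \<le> n \<Longrightarrow> primeideal (p i) R" "\<And>i. i < n \<Longrightarrow> p i \<subset> p (Suc i)"
  shows "enat n \<le> height R (p n)"
  unfolding height_def using assms by (intro Sup_upper) blast

lemma height_gt_0_imp_smaller_prime:
  assumes "height R P > 0"
  obtains Q where "primeideal Q R" "Q \<subset> P"
proof -
  from assms obtain n p where p: "0 < enat n" "\<forall>i\<le>n. primeideal (p i) R" "\<forall>i<n. p i \<subset> p (Suc i)" "p n = P"
    unfolding height_def less_Sup_iff by auto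
  then obtain k where "n = Suc k" by (cases n) (auto simp: zero_enat_def)
  with p that[of "p k"] show ?thesis by auto
qed

lemma height_one_no_chain:
  assumes "height R P = 1" "primeideal P R" "primeideal Q R" "primeideal Q' R" "Q' \<subset> Q" "Q \<subset> P"
  shows False
proof -
  define p where "p = (\<lambda>i::nat. if i = 0 then Q' else if i = 1 then Q else P)"
  have "enat 2 \<le> height R (p 2)"
    by (rule height_geI) (use assms in \<open>auto simp: p_def\<close>)
  then show False using assms(1) by (simp add: p_def one_enat_def)
qed

text \<open>\<open>Q\<close> gives a chain of length one. In a longer chain the two primes just
  below \<open>P\<close> form a configuration that \<open>no\<close> excludes.\<close>

lemma height_oneI:
  assumes "primeideal P R" "primeideal Q R" "Q \<subset> P"
    and no: "\<And>Q Q'. primeideal Q R \<Longrightarrow> primeideal Q' R \<Longrightarrow> Q' \<subset> Q \<Longrightarrow> Q \<subset> P \<Longrightarrow> False"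
  shows "height R P = 1"
proof (rule antisym)
  define p where "p = (\<lambda>i::nat. if i = 0 then Q else P)"
  have "enat 1 \<le> height R (p 1)"
    by (rule height_geI) (use assms in \<open>auto simp: p_def\<close>)
  then show "1 \<le> height R P" by (simp add: p_def one_enat_def)
  show "height R P \<le> 1"
    unfolding height_def
  proof (rule Sup_least, clarify)
    fix n p assume p: "\<forall>i\<le>n. primeideal (p i) R" "\<forall>i<n. p i \<subset> p (Suc i)" "P = p n"
    have "n \<le> 1"
    proof (rule ccontr)
      assume "\<not> n \<le> 1"
      then obtain k where "n = Suc (Suc k)" by (metis One_nat_def le0 le_SucI le_refl not0_implies_Suc)
      with p no[of "p (Suc k)" "p k"] show False by auto
    qed
    then show "enat n \<le> 1" by (simp add: one_enat_def)
  qed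
qed

end

section \<open>Associated primes in Noetherian rings\<close>

locale noetherian_cring = noetherian_ring R + cring R for R (structure)

context noetherian_cring
begin

text \<open>Among the colon ideals of multiples of \<open>s\<close> that miss \<open>W\<close>, a
  maximal one is prime. With \<open>W\<close> trivial this finds an associated prime for an element
  outside \<open>I\<close>; with \<open>W\<close> the complement of a prime \<open>P\<close> and
  \<open>s\<close> the unit it finds an associated prime of \<open>I\<close> inside
  \<open>P\<close>.\<close>

lemma exists_prime_colon:
  assumes I: "ideal I R" and s: "s \<in> carrier R" and W: "submonoid W R" and "colon R I s \<inter> W = {}"
  obtains t where "t \<in> carrier R" "primeideal (colon R I (s \<otimes> t)) R" "colon R I (s \<otimes> t) \<inter> W = {}"
proof -
  interpret W: submonoid W R by fact
  define C where "C = {colon R I (s \<otimes> t) | t. t \<in> carrier R \<and> colon R I (s \<otimes> t) \<inter> W = {}}"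
  have "colon R I (s \<otimes> \<one>) \<in> C" using assms(4) s unfolding C_def by fastforce
  moreover have "ideal J R" if "J \<in> C" for J
    using that s colon_ideal[OF I] by (auto simp: C_def)
  ultimately obtain M where M: "M \<in> C" "\<And>J. J \<in> C \<Longrightarrow> M \<subseteq> J \<Longrightarrow> J = M"
    using exists_maximal_ideal_in[of C] by blast
  from M(1) obtain t where t: "t \<in> carrier R" "M = colon R I (s \<otimes> t)" "M \<inter> W = {}"
    by (auto simp: C_def)
  have max: "colon R I (s \<otimes> t \<otimes> c) = M" if "c \<in> carrier R" "colon R I (s \<otimes> t \<otimes> c) \<inter> W = {}" for c
    using that t(1) s colon_mono_mult[OF I, of "s \<otimes> t" c]
    by (intro M(2)) (auto simp: C_def t(2) m_assoc)
  have "primeideal M R"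
  proof (rule primeidealI)
    show "ideal M R" using t s colon_ideal[OF I] by simp
    show "cring R" by (rule is_cring)
    show "carrier R \<noteq> M" using t(3) W.one_closed by auto
    fix a b assume ab: "a \<in> carrier R" "b \<in> carrier R" "a \<otimes> b \<in> M"
    show "a \<in> M \<or> b \<in> M"
    proof (cases "colon R I (s \<otimes> t \<otimes> b) \<inter> W = {}")
      case True
      then have "colon R I (s \<otimes> t \<otimes> b) = M" by (rule max[OF ab(2)])
      moreover have "a \<otimes> (s \<otimes> t \<otimes> b) = a \<otimes> b \<otimes> (s \<otimes> t)" using ab s t(1) by (simp add: m_ac)
      then have "a \<in> colon R I (s \<otimes> t \<otimes> b)" using ab t(2) by (simp add: colon_def)
      ultimately show ?thesis by simp
    next
      case False
      \<comment> \<open>\<open>colon R I (s \<otimes> t \<otimes> u)\<close> still misses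
        \<open>W\<close>, since an element \<open>v\<close> of both would put
        \<open>v \<otimes> u\<close> into \<open>M\<close> and \<open>W\<close>. By maximality it is
        \<open>M\<close>, and it contains \<open>b\<close> by the choice of
        \<open>u\<close>.\<close>
      then obtain u where u: "u \<in> W" "u \<in> carrier R" "u \<otimes> (s \<otimes> t \<otimes> b) \<in> I" by (auto simp: colon_def)
      have "colon R I (s \<otimes> t \<otimes> u) \<inter> W = {}"
      proof -
        have False if "v \<in> W" "v \<otimes> (s \<otimes> t \<otimes> u) \<in> I" for v
        proof -
          have "v \<otimes> u \<otimes> (s \<otimes> t) = v \<otimes> (s \<otimes> t \<otimes> u)"
            using that(1) W.subset u s t(1) by (simp add: m_ac subset_iff)
          then have "v \<otimes> u \<in> M \<inter> W"
            using that W.m_closed[OF that(1) u(1)] W.subset t(2) by (auto simp: colon_def)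
          with t(3) show False by simp
        qed
        then show ?thesis by (auto simp: colon_def)
      qed
      then have "colon R I (s \<otimes> t \<otimes> u) = M" by (rule max[OF u(2)])
      moreover have "b \<otimes> (s \<otimes> t \<otimes> u) = u \<otimes> (s \<otimes> t \<otimes> b)" using ab s t(1) u by (simp add: m_ac)
      then have "b \<in> colon R I (s \<otimes> t \<otimes> u)" using u ab by (simp add: colon_def)
      ultimately show ?thesis by simp
    qed
  qed
  with that t show ?thesis by blast
qed

text \<open>If \<open>x\<close> were outside \<open>I\<close>, some multiple
  \<open>x \<otimes> t\<close> would have a prime annihilator modulo \<open>I\<close>. A multiplier
  outside that prime which takes \<open>x\<close> into \<open>I\<close> also kills
  \<open>x \<otimes> t\<close> modulo \<open>I\<close>, so it would lie in the prime after
  all.\<close>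

lemma mem_ideal_if_locally:
  assumes I: "ideal I R" and x: "x \<in> carrier R"
    and loc: "\<And>P t. primeideal P R \<Longrightarrow> t \<in> carrier R \<Longrightarrow> P = colon R I t \<Longrightarrow> x \<in> saturation R P I"
  shows "x \<in> I"
proof (rule ccontr)
  interpret I: ideal I R by fact
  assume "x \<notin> I"
  then have "colon R I x \<inter> {\<one>} = {}" using x by (auto simp: colon_def)
  moreover have "submonoid {\<one>} R" by standard auto
  ultimately obtain t where t: "t \<in> carrier R" "primeideal (colon R I (x \<otimes> t)) R"
    using exists_prime_colon[OF I x] by blast
  from loc[OF t(2) _ refl] x t(1) obtain u where
    u: "u \<in> carrier R" "u \<notin> colon R I (x \<otimes> t)" "u \<otimes> x \<in> I"
    by (auto simp: saturation_def)
  have "u \<otimes> (x \<otimes> t) \<in> I" using I.I_r_closed[OF u(3) t(1)] u x t by (simp add: m_assoc)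
  with u(1,2) show False by (simp add: colon_def)
qed

text \<open>Noetherian induction replaces primary decomposition: the ideals \<open>J F\<close> grow
  with \<open>F\<close>, so some finite \<open>F\<close> gives a maximal one. Were \<open>P\<close>
  in \<open>T\<close> but not in \<open>F\<close>, the element \<open>z\<close> with
  \<open>P = colon R I z\<close> would enlarge \<open>J F\<close> once \<open>P\<close> is added to
  \<open>F\<close>: by incomparability each other \<open>Q\<close> misses an element of
  \<open>P\<close>, and that element takes \<open>z\<close> into \<open>I\<close>, while at
  \<open>P\<close> itself no multiplier does.\<close>

lemma finite_incomparable_associated_primes:
  assumes I: "ideal I R"
    and T: "\<And>P. P \<in> T \<Longrightarrow> primeideal P R \<and> (\<exists>t\<in>carrier R. P = colon R I t)"
    and inc: "\<And>P Q. P \<in> T \<Longrightarrow> Q \<in> T \<Longrightarrow> P \<subseteq> Q \<Longrightarrow> P = Q"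
  shows "finite T"
proof -
  \<comment> \<open>The intersection with the carrier keeps \<open>J F\<close> an ideal when
    \<open>T - F\<close> is empty.\<close>
  define J where "J = (\<lambda>F. carrier R \<inter> (\<Inter>P\<in>T - F. saturation R P I))"
  have idJ: "ideal (J F) R" for F
  proof (cases "T - F = {}")
    case True
    then show ?thesis unfolding J_def True by (simp add: oneideal)
  next
    case False
    then have "J F = (\<Inter>P\<in>T - F. saturation R P I)" by (auto simp: J_def saturation_def)
    moreover have "ideal (\<Inter>((\<lambda>P. saturation R P I) ` (T - F))) R"
      by (rule i_Intersect) (use False T saturation_ideal[OF _ I] in auto)
    ultimately show ?thesis by simp
  qed
  obtain M where M: "M \<in> J ` {F. finite F \<and> F \<subseteq> T}" "\<And>K. K \<in> J ` {F. finite F \<and> F \<subseteq> T} \<Longrightarrow> M \<subseteq> K \<Longrightarrow> K = M"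
  proof (rule exists_maximal_ideal_in[of "J ` {F. finite F \<and> F \<subseteq> T}"])
    show "J ` {F. finite F \<and> F \<subseteq> T} \<noteq> {}" by auto
    show "ideal K R" if "K \<in> J ` {F. finite F \<and> F \<subseteq> T}" for K using that idJ by auto
  qed blast
  then obtain F where F: "finite F" "F \<subseteq> T" "M = J F" by auto
  have "T \<subseteq> F"
  proof
    fix P assume P: "P \<in> T"
    show "P \<in> F"
    proof (rule ccontr)
      assume PF: "P \<notin> F"
      obtain z where z: "z \<in> carrier R" "P = colon R I z" using T[OF P] by blast
      have "J F \<subseteq> J (insert P F)" by (auto simp: J_def)
      moreover have "J (insert P F) \<in> J ` {F. finite F \<and> F \<subseteq> T}" using F P by auto
      ultimately have "J (insert P F) = J F" using M(2) F(3) by simp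
      moreover have "z \<in> J (insert P F)"
      proof -
        have "z \<in> saturation R Q I" if Q: "Q \<in> T" "Q \<noteq> P" for Q
        proof -
          obtain u where u: "u \<in> P" "u \<notin> Q" using inc[OF P Q(1)] Q(2) by auto
          then show ?thesis using z by (auto simp: saturation_def colon_def)
        qed
        then show ?thesis using z(1) by (auto simp: J_def)
      qed
      moreover have "z \<notin> J F" using P PF z by (auto simp: J_def saturation_def colon_def)
      ultimately show False by simp
    qed
  qed
  then show ?thesis using F(1) finite_subset by blast
qed

end

section \<open>Valuations at height one primes\<close>

locale noetherian_normal_domain = noetherian_cring R + domain R for R (structure) +
  assumes normal: "normal_domain R"

context noetherian_normal_domain
begin

text \<open>The element \<open>z/y\<close> is integral: with \<open>b\<^sub>n = (z/y)\<^sup>n b\<^sub>0\<close> in \<open>J\<close>, the ascending chain of the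
  ideals generated by \<open>b\<^sub>0, \<dots>, b\<^sub>n\<^sub>-\<^sub>1\<close> becomes stationary, which gives a monic equation.\<close>

lemma normal_quotient:
  assumes J: "ideal J R" "J \<noteq> {\<zero>}" and y: "y \<in> carrier R" "y \<noteq> \<zero>" and z: "z \<in> carrier R"
    and zJ: "\<And>b. b \<in> J \<Longrightarrow> \<exists>b'\<in>J. z \<otimes> b = y \<otimes> b'"
  shows "z \<in> PIdl y"
proof -
  interpret J: ideal J R by fact
  define W where "W = carrier R - {\<zero>}"
  have W: "submonoid W R"
    unfolding W_def using submonoid_compl_prime[OF zeroprimeideal] .
  define K where "K = localization R W"
  interpret K: cring K unfolding K_def by (rule localization_cring[OF W])
  define L where "L = loc_map R W"
  have Lh: "ring_hom_ring R K L"
    unfolding K_def L_def by (rule ring_hom_ringI2[OF ring_axioms _ loc_map_hom[OF W]])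
      (use K.ring_axioms K_def in simp)
  interpret L: ring_hom_ring R K L by (rule Lh)
  have oneW: "\<one> \<in> W" using submonoid.one_closed[OF W] .
  have L0: "L r = \<zero>\<^bsub>K\<^esub> \<longleftrightarrow> r = \<zero>" if "r \<in> carrier R" for r
  proof -
    have "L r = \<zero>\<^bsub>K\<^esub> \<longleftrightarrow> fraction R W r \<one> = fraction R W \<zero> \<one>"
      by (simp add: L_def K_def loc_map_def localization_def)
    also have "\<dots> \<longleftrightarrow> (\<exists>t\<in>W. t \<otimes> r = \<zero>)"
      using that oneW by (subst frac_eq_iff[OF W]) (auto simp: minus_eq)
    also have "\<dots> \<longleftrightarrow> r = \<zero>"
      using that oneW integral by (auto simp: W_def intro!: bexI[of _ \<one>])
    finally show ?thesis .
  qed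
  define x where "x = fraction R W z y"
  have yW: "y \<in> W" using y by (simp add: W_def)
  have xK: "x \<in> carrier K" using z yW by (auto simp: x_def K_def localization_carrier)
  have Lx: "L r \<otimes>\<^bsub>K\<^esub> x = L r'" if "r \<in> carrier R" "r' \<in> carrier R" "z \<otimes> r = y \<otimes> r'" for r r'
  proof -
    have "L r \<otimes>\<^bsub>K\<^esub> x = fraction R W (r \<otimes> z) y"
      using that z yW oneW y by (simp add: L_def loc_map_def x_def K_def localization_mult[OF W])
    also have "\<dots> = L r'"
      unfolding L_def loc_map_def using that z y yW oneW by (intro frac_eqI[OF W]) (auto simp: m_comm)
    finally show ?thesis .
  qed
  obtain b0 where b0: "b0 \<in> J" "b0 \<noteq> \<zero>" using J J.zero_closed by blast
  obtain g where g: "\<And>b. b \<in> J \<Longrightarrow> g b \<in> J \<and> z \<otimes> b = y \<otimes> g b" using zJ by metis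
  define b where "b = (\<lambda>n. (g ^^ n) b0)"
  have bJ: "b n \<in> J" and b_Suc: "z \<otimes> b n = y \<otimes> b (Suc n)" for n
  proof -
    show "b n \<in> J" by (induction n) (auto simp: b_def b0 g)
    then show "z \<otimes> b n = y \<otimes> b (Suc n)" using g by (simp add: b_def)
  qed
  have bc: "b n \<in> carrier R" for n using bJ J.Icarr by blast
  have Lb: "L (b n) = L b0 \<otimes>\<^bsub>K\<^esub> x [^]\<^bsub>K\<^esub> n" for n
  proof (induction n)
    case 0
    show ?case using b0 J.Icarr by (simp add: b_def)
  next
    case (Suc n)
    have "L (b (Suc n)) = L (b n) \<otimes>\<^bsub>K\<^esub> x" using Lx[OF bc bc b_Suc] by simp
    then show ?case using Suc xK b0 J.Icarr by (simp add: K.m_assoc)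
  qed
  \<comment> \<open>\<open>M n\<close> is generated by the first \<open>n\<close> members of the
    sequence; \<open>M 0\<close> is the zero ideal.\<close>
  define M where "M = rec_nat {\<zero>} (\<lambda>n I. I <+> PIdl (b n))"
  have M_Suc: "M (Suc n) = M n <+> PIdl (b n)" for n by (simp add: M_def)
  have M_ideal: "ideal (M n) R" for n
    by (induction n) (simp_all add: M_def zeroideal add_ideals cgenideal_ideal bc)
  \<comment> \<open>An element of \<open>M n\<close> divided by \<open>b0\<close> is a polynomial
    expression in \<open>x\<close> with \<open>n\<close> coefficients from the image of
    \<open>R\<close>. Leading coefficients come first, so the new summand
    \<open>s \<otimes> b n\<close> prepends a coefficient for the power \<open>n\<close>.\<close>
  have poly: "\<exists>p. length p = n \<and> set p \<subseteq> L ` carrier R \<and> L c = L b0 \<otimes>\<^bsub>K\<^esub> K.eval p x"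
    if "c \<in> M n" for n c
    using that
  proof (induction n arbitrary: c)
    case 0
    then have "c = \<zero>" by (simp add: M_def)
    then show ?case using b0 J.Icarr by simp
  next
    case (Suc n)
    then obtain d s where d: "d \<in> M n" "s \<in> carrier R" "c = d \<oplus> s \<otimes> b n"
      by (auto simp: M_Suc set_add_def' cgenideal_def)
    obtain p where p: "length p = n" "set p \<subseteq> L ` carrier R" "L d = L b0 \<otimes>\<^bsub>K\<^esub> K.eval p x"
      using Suc.IH[OF d(1)] by blast
    have dc: "d \<in> carrier R" using ideal.Icarr[OF M_ideal d(1)] .
    have pK: "K.eval p x \<in> carrier K" using p(2) xK by (intro K.eval_in_carrier) auto
    have "L c = L d \<oplus>\<^bsub>K\<^esub> L s \<otimes>\<^bsub>K\<^esub> L (b n)" using d dc bc by simp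
    also have "\<dots> = L b0 \<otimes>\<^bsub>K\<^esub> K.eval (L s # p) x"
      unfolding Lb p(3) using d(2) b0 J.Icarr pK xK p(1)
      by (simp add: K.r_distr K.m_ac K.a_comm)
    finally show ?case using p d(2) by (intro exI[of _ "L s # p"]) auto
  qed
  have M_mono: "M n \<subseteq> M (n + k)" for n k
  proof (induction k)
    case (Suc k)
    have "M (n + k) \<subseteq> M (Suc (n + k))"
    proof
      fix c assume c: "c \<in> M (n + k)"
      have "c = c \<oplus> \<zero>" "\<zero> \<in> PIdl (b (n + k))"
        using ideal.Icarr[OF M_ideal c] additive_subgroup.zero_closed[OF ideal.axioms(1)[OF cgenideal_ideal[OF bc]]]
        by auto
      with c show "c \<in> M (Suc (n + k))" unfolding M_Suc set_add_def' by blast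
    qed
    with Suc show ?case by auto
  qed simp
  obtain N where N: "N \<in> range M" "\<And>I. I \<in> range M \<Longrightarrow> N \<subseteq> I \<Longrightarrow> I = N"
  proof (rule exists_maximal_ideal_in[of "range M"])
    show "ideal I R" if "I \<in> range M" for I using that M_ideal by auto
  qed auto
  then obtain n where n: "N = M n" by auto
  have "M (Suc n) = M n" using N(2)[of "M (Suc n)"] M_mono[of n 1] n by simp
  \<comment> \<open>At the stationary index this puts the negative of \<open>b n\<close> into
    \<open>M n\<close>, so it is \<open>b0\<close> times a polynomial \<open>p\<close> in
    \<open>x\<close> of degree below \<open>n\<close>. Prepending the coefficient one to
    \<open>p\<close> then yields the monic equation directly.\<close>
  moreover have "\<ominus> b n \<in> M (Suc n)"
  proof -
    have "\<ominus> b n \<in> PIdl (b n)"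
      using additive_subgroup.a_inv_closed[OF ideal.axioms(1)[OF cgenideal_ideal[OF bc]] cgenideal_self[OF bc]] .
    moreover have "\<ominus> b n = \<zero> \<oplus> \<ominus> b n" "\<zero> \<in> M n"
      using bc additive_subgroup.zero_closed[OF ideal.axioms(1)[OF M_ideal]] by auto
    ultimately show ?thesis unfolding M_Suc set_add_def' by blast
  qed
  ultimately obtain p where p: "length p = n" "set p \<subseteq> L ` carrier R"
    "L (\<ominus> b n) = L b0 \<otimes>\<^bsub>K\<^esub> K.eval p x" using poly[of "\<ominus> b n" n] by auto
  have pK: "K.eval p x \<in> carrier K" using p(2) xK by (intro K.eval_in_carrier) auto
  have Lb0: "L b0 \<in> carrier K" using b0 J.Icarr by simp
  define v where "v = K.eval (\<one>\<^bsub>K\<^esub> # p) x"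
  have vK: "v \<in> carrier K" unfolding v_def using p(2) xK by (intro K.eval_in_carrier) auto
  have "L b0 \<otimes>\<^bsub>K\<^esub> v = L (b n) \<oplus>\<^bsub>K\<^esub> L (\<ominus> b n)"
    unfolding Lb p(3) v_def using pK xK Lb0 p(1) by (simp add: K.r_distr)
  also have "\<dots> = \<zero>\<^bsub>K\<^esub>" using bc by (simp add: K.r_neg)
  finally have bv: "L b0 \<otimes>\<^bsub>K\<^esub> v = \<zero>\<^bsub>K\<^esub>" .
  have "b0 \<in> W" using b0 J.Icarr by (simp add: W_def)
  \<comment> \<open>\<open>K\<close> is only available as a commutative ring, so \<open>b0\<close>
    is cancelled with its explicit inverse.\<close>
  define i where "i = fraction R W \<one> b0"
  have iK: "i \<in> carrier K" using \<open>b0 \<in> W\<close> by (auto simp: i_def K_def localization_carrier)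
  have "i \<otimes>\<^bsub>K\<^esub> L b0 = fraction R W b0 b0"
    using \<open>b0 \<in> W\<close> oneW b0 J.Icarr by (simp add: i_def L_def K_def loc_map_def localization_mult[OF W])
  also have "\<dots> = \<one>\<^bsub>K\<^esub>"
  proof -
    have "\<one>\<^bsub>K\<^esub> = fraction R W \<one> \<one>" by (simp add: K_def localization_def)
    moreover have "fraction R W b0 b0 = fraction R W \<one> \<one>"
      by (rule frac_eqI[OF W]) (use \<open>b0 \<in> W\<close> oneW b0 J.Icarr in simp_all)
    ultimately show ?thesis by simp
  qed
  finally have "v = i \<otimes>\<^bsub>K\<^esub> (L b0 \<otimes>\<^bsub>K\<^esub> v)"
    using iK vK Lb0 by (simp add: K.m_assoc[symmetric])
  then have v0: "v = \<zero>\<^bsub>K\<^esub>" using bv iK by simp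
  have "integral_over K (L ` carrier R) x"
  proof -
    have "\<one>\<^bsub>K\<^esub> \<in> L ` carrier R" using L.hom_one by (metis imageI one_closed)
    moreover have "\<one>\<^bsub>K\<^esub> \<noteq> \<zero>\<^bsub>K\<^esub>" using L0[of \<one>] by simp
    ultimately show ?thesis
      unfolding integral_over_def using p(2) v0
      by (intro exI[of _ "\<one>\<^bsub>K\<^esub> # p"]) (auto simp: polynomial_def v_def)
  qed
  then have "x \<in> L ` carrier R"
    using normal xK unfolding normal_domain_def Let_def K_def L_def W_def by blast
  then obtain c where c: "c \<in> carrier R" "fraction R W z y = fraction R W c \<one>"
    by (auto simp: x_def L_def loc_map_def)
  then obtain t where t: "t \<in> W" "t \<otimes> (\<one> \<otimes> z \<ominus> y \<otimes> c) = \<zero>"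
    using frac_eq_iff[OF W z yW c(1) oneW] by auto
  then have "z \<ominus> y \<otimes> c = \<zero>" using integral[of t "z \<ominus> y \<otimes> c"] z y c by (auto simp: W_def)
  then have "z = c \<otimes> y" using z y c by (simp add: m_comm)
  then show ?thesis using c by (auto simp: cgenideal_def)
qed

text \<open>Multiplication by the fraction \<open>z / y\<close> takes \<open>P\<close> into the
  ring. If it took \<open>P\<close> into \<open>P\<close>, then \<open>normal_quotient\<close> would
  give \<open>z\<close> in the ideal of \<open>y\<close>, and \<open>P\<close> would contain the
  unit. So \<open>z \<otimes> p = y \<otimes> u\<close> for some \<open>p\<close> in
  \<open>P\<close> and \<open>u\<close> outside \<open>P\<close>. For any \<open>p'\<close> in
  \<open>P\<close>, comparing with \<open>z \<otimes> p' = y \<otimes> u'\<close> gives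
  \<open>u \<otimes> p' = u' \<otimes> p\<close>, which says that \<open>p\<close> generates
  \<open>P\<close> locally.\<close>

lemma exists_uniformizer_of_colon:
  assumes P: "primeideal P R" and y: "y \<in> carrier R" "y \<noteq> \<zero>"
    and z: "z \<in> carrier R" "P = colon R (PIdl y) z"
  shows "\<exists>p\<in>P. P \<subseteq> saturation R P (PIdl p)"
proof -
  interpret P: primeideal P R by fact
  have zP: "\<exists>b'\<in>carrier R. z \<otimes> b = y \<otimes> b'" if "b \<in> P" for b
  proof -
    from that have "b \<in> colon R (PIdl y) z" unfolding z(2)[symmetric] .
    then obtain c where c: "b \<in> carrier R" "c \<in> carrier R" "b \<otimes> z = c \<otimes> y"
      by (auto simp: colon_def cgenideal_def)
    then have "z \<otimes> b = y \<otimes> c" using y z(1) by (simp add: m_comm)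
    then show ?thesis using c(2) by blast
  qed
  have "\<exists>p\<in>P. \<exists>u\<in>carrier R - P. z \<otimes> p = y \<otimes> u"
  proof (rule ccontr)
    assume "\<not> ?thesis"
    then have *: "\<exists>b'\<in>P. z \<otimes> b = y \<otimes> b'" if "b \<in> P" for b using zP[OF that] that by blast
    have "y \<in> colon R (PIdl y) z"
      using colon_superset[OF cgenideal_ideal[OF y(1)] z(1)] cgenideal_self[OF y(1)] by blast
    then have "y \<in> P" unfolding z(2)[symmetric] .
    then have "z \<in> PIdl y" using normal_quotient[OF P.is_ideal _ y z(1) *] y by auto
    then have "\<one> \<in> colon R (PIdl y) z" using z(1) by (simp add: colon_def)
    then have "\<one> \<in> P" unfolding z(2)[symmetric] .
    then show False using primeideal_one_notin[OF P] by simp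
  qed
  then obtain p u where p: "p \<in> P" "u \<in> carrier R - P" "z \<otimes> p = y \<otimes> u" by blast
  have "p' \<in> saturation R P (PIdl p)" if p': "p' \<in> P" for p'
  proof -
    obtain u' where u': "u' \<in> carrier R" "z \<otimes> p' = y \<otimes> u'" using zP[OF p'] by blast
    have c: "p \<in> carrier R" "p' \<in> carrier R" "u \<in> carrier R" using p p' P.Icarr by auto
    have "y \<otimes> (u \<otimes> p') = (z \<otimes> p) \<otimes> p'" unfolding p(3) using c y by (simp add: m_assoc)
    also have "\<dots> = (z \<otimes> p') \<otimes> p" using c z(1) by (simp add: m_ac)
    also have "\<dots> = y \<otimes> (u' \<otimes> p)" unfolding u'(2) using c y u' by (simp add: m_assoc)
    finally have "u \<otimes> p' = u' \<otimes> p" using y c u' m_lcancel by simp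
    then show ?thesis using c p u' by (auto simp: mem_saturation_PIdl)
  qed
  then show ?thesis using p(1) by blast
qed

text \<open>\<open>good y\<close> says that \<open>y\<close> is left of \<open>x\<close> after some
  divisions by \<open>p\<close>, up to a multiplier outside \<open>P\<close>. Take such a
  \<open>y\<close> whose local principal ideal is maximal. If \<open>y\<close> were in
  \<open>P\<close>, one more division would leave \<open>y'\<close> with the same local ideal;
  cancelling \<open>y'\<close> then exhibits \<open>v \<otimes> t\<close>, a product of elements
  outside \<open>P\<close>, as a multiple of \<open>p\<close>.\<close>

lemma uniformizer_form:
  assumes P: "primeideal P R" and p: "p \<in> P" "P \<subseteq> saturation R P (PIdl p)"
    and x: "x \<in> carrier R" "x \<noteq> \<zero>"
  shows "\<exists>n::nat. \<exists>u\<in>carrier R - P. \<exists>w\<in>carrier R - P. u \<otimes> x = w \<otimes> p [^] n"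
proof -
  interpret P: primeideal P R by fact
  have pc: "p \<in> carrier R" using p P.Icarr by blast
  define good where "good = (\<lambda>y. y \<in> carrier R \<and> (\<exists>n::nat. \<exists>u\<in>carrier R - P. u \<otimes> x = y \<otimes> p [^] n))"
  define C where "C = {saturation R P (PIdl y) | y. good y}"
  have "good x" using x primeideal_one_notin[OF P]
    by (auto simp: good_def intro!: exI[of _ 0] bexI[of _ \<one>])
  then obtain M where M: "M \<in> C" "\<And>I. I \<in> C \<Longrightarrow> M \<subseteq> I \<Longrightarrow> I = M"
  proof (elim exists_maximal_ideal_in[of C, rotated 2])
    show "ideal I R" if "I \<in> C" for I
      using that saturation_ideal[OF P cgenideal_ideal] by (auto simp: C_def good_def)
  qed (auto simp: C_def)
  then obtain y where y: "good y" "M = saturation R P (PIdl y)" by (auto simp: C_def)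
  then obtain n u where u: "y \<in> carrier R" "u \<in> carrier R - P" "u \<otimes> x = y \<otimes> p [^] (n::nat)"
    by (auto simp: good_def)
  have "y \<notin> P"
  proof
    assume "y \<in> P"
    then obtain v y' where v: "v \<in> carrier R - P" "y' \<in> carrier R" "v \<otimes> y = y' \<otimes> p"
      using subsetD[OF p(2) \<open>y \<in> P\<close>] mem_saturation_PIdl[OF pc] by blast
    have "v \<otimes> u \<otimes> x = v \<otimes> (u \<otimes> x)" using u(1,2) v(1,2) x by (simp add: m_assoc)
    also have "\<dots> = (v \<otimes> y) \<otimes> p [^] n" unfolding u(3) using u(1) v(1) pc by (simp add: m_assoc)
    also have "\<dots> = y' \<otimes> p [^] Suc n"
      unfolding v(3) nat_pow_Suc using v(2) pc by (simp add: m_ac)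
    finally have "good y'"
      using v(2) primeideal_mult_notin[OF P v(1) u(2)] unfolding good_def by blast
    moreover have "PIdl y \<subseteq> saturation R P (PIdl y')"
    proof
      fix r assume "r \<in> PIdl y"
      then obtain c where c: "c \<in> carrier R" "r = c \<otimes> y" by (auto simp: cgenideal_def)
      have "v \<otimes> r = (c \<otimes> p) \<otimes> y'"
      proof -
        have "v \<otimes> r = c \<otimes> (v \<otimes> y)" using c u(1) v(1,2) by (simp add: m_ac)
        then show ?thesis unfolding v(3) using c v(1,2) pc by (simp add: m_ac)
      qed
      then show "r \<in> saturation R P (PIdl y')"
        using c u(1) v(1,2) pc m_closed[OF c(1) pc] unfolding mem_saturation_PIdl[OF v(2)] by blast
    qed
    then have "M \<subseteq> saturation R P (PIdl y')"
      unfolding y(2) by (rule saturation_subset_saturation[OF P])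
    ultimately have "saturation R P (PIdl y') = M"
      by (intro M(2)) (auto simp: C_def)
    moreover have "y' \<in> saturation R P (PIdl y')"
      using subset_saturation[OF P, of "PIdl y'"] cgenideal_self[OF v(2)]
        ideal.Icarr[OF cgenideal_ideal[OF v(2)]] by blast
    ultimately obtain t c where t: "t \<in> carrier R - P" "c \<in> carrier R" "t \<otimes> y' = c \<otimes> y"
      using y(2) by (auto simp: mem_saturation_PIdl[OF u(1)])
    have "y' \<noteq> \<zero>"
    proof
      assume "y' = \<zero>"
      then have "v \<otimes> y = \<zero>" using v(3) pc by simp
      then have "y = \<zero>" using v(1) u(1) integral P.zero_closed by blast
      then have "u \<otimes> x = \<zero>" using u(3) pc by simp
      then show False using u(2) x integral P.zero_closed by blast
    qed
    have "y' \<otimes> (v \<otimes> t) = v \<otimes> (t \<otimes> y')" using v(1,2) t(1,2) by (simp add: m_ac)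
    also have "\<dots> = c \<otimes> (v \<otimes> y)" unfolding t(3) using v(1,2) t(1,2) u(1) by (simp add: m_ac)
    also have "\<dots> = y' \<otimes> (c \<otimes> p)" unfolding v(3) using v(1,2) t(1,2) pc by (simp add: m_ac)
    finally have "v \<otimes> t = c \<otimes> p" using \<open>y' \<noteq> \<zero>\<close> v(1,2) t(1,2) pc m_lcancel by simp
    then have "v \<otimes> t \<in> P" using P.I_l_closed[OF p(1) t(2)] by simp
    then show False using primeideal_mult_notin[OF P v(1) t(1)] by simp
  qed
  then show ?thesis using u by blast
qed

section \<open>Height one primes and associated primes of principal ideals\<close>

lemma height_one_nonzero: "P \<in> height_one_primes R \<Longrightarrow> P \<noteq> {\<zero>}"
proof
  assume P: "P \<in> height_one_primes R" "P = {\<zero>}"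
  then obtain Q where "primeideal Q R" "Q \<subset> {\<zero>}"
    using height_gt_0_imp_smaller_prime[of P] by (auto simp: height_one_primes_def)
  then show False
    using additive_subgroup.zero_closed[OF ideal.axioms(1)[OF primeideal.axioms(1)]] by blast
qed

lemma zero_psubset_ideal: "ideal I R \<Longrightarrow> I \<noteq> {\<zero>} \<Longrightarrow> {\<zero>} \<subset> I"
  using additive_subgroup.zero_closed[OF ideal.axioms(1)] by blast

lemma height_one_minimal:
  assumes "P \<in> height_one_primes R" "primeideal Q R" "Q \<noteq> {\<zero>}" "Q \<subseteq> P"
  shows "Q = P"
  using height_one_no_chain[of P Q "{\<zero>}"] assms zeroprimeideal
    zero_psubset_ideal[OF primeideal.axioms(1)[OF assms(2)]]
  by (auto simp: height_one_primes_def)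

text \<open>A nonzero prime \<open>Q\<close> below \<open>P\<close> contains some
  \<open>x \<noteq> \<zero>\<close>. By \<open>uniformizer_form\<close> a factor outside
  \<open>P\<close> times a power of \<open>p\<close> lies in \<open>Q\<close>, so \<open>p\<close>
  lies in \<open>Q\<close>, and then \<open>Q\<close> contains all of \<open>P\<close>.\<close>

lemma height_one_of_uniformizer:
  assumes P: "primeideal P R" "P \<noteq> {\<zero>}" and p: "p \<in> P" "P \<subseteq> saturation R P (PIdl p)"
  shows "P \<in> height_one_primes R"
proof -
  have "height R P = 1"
  proof (rule height_oneI[OF P(1) zeroprimeideal])
    show "{\<zero>} \<subset> P" using zero_psubset_ideal[OF primeideal.axioms(1)[OF P(1)] P(2)] .
    fix Q Q' assume Q: "primeideal Q R" "primeideal Q' R" "Q' \<subset> Q" "Q \<subset> P"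
    interpret Q: primeideal Q R by fact
    interpret Q': primeideal Q' R by fact
    obtain x where x: "x \<in> Q" "x \<noteq> \<zero>" using Q(3) Q'.zero_closed by blast
    then obtain n u w where n: "u \<in> carrier R - P" "w \<in> carrier R - P" "u \<otimes> x = w \<otimes> p [^] (n::nat)"
      using uniformizer_form[OF P(1) p, of x] Q.Icarr by blast
    have pc: "p \<in> carrier R" using p(1) ideal.Icarr[OF primeideal.axioms(1)[OF P(1)]] by blast
    have "p \<notin> Q"
    proof
      assume "p \<in> Q"
      then have "PIdl p \<subseteq> Q" by (rule cgenideal_minimal[OF Q.is_ideal])
      then have "P \<subseteq> Q"
        using p(2) saturation_mono saturation_subset_prime[OF P(1) Q(1)] Q(4) by blast
      with Q(4) show False by simp
    qed
    then have "p [^] n \<in> carrier R - Q" using primeideal_pow_notin[OF Q(1)] pc by blast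
    then have "w \<otimes> p [^] n \<in> carrier R - Q" using primeideal_mult_notin[OF Q(1)] n(2) Q(4) by blast
    moreover have "w \<otimes> p [^] n \<in> Q" using Q.I_l_closed[OF x(1)] n by (metis DiffD1)
    ultimately show False by simp
  qed
  with P show ?thesis by (simp add: height_one_primes_def)
qed

text \<open>\<open>exists_prime_colon\<close> yields an associated prime of \<open>I\<close> inside
  \<open>P\<close>. It contains \<open>I\<close>, so it is nonzero, and minimality of
  \<open>P\<close> among nonzero primes makes it equal to \<open>P\<close>.\<close>

lemma height_one_eq_colon:
  assumes P: "P \<in> height_one_primes R" and I: "ideal I R" "I \<noteq> {\<zero>}" "I \<subseteq> P"
  obtains t where "t \<in> carrier R" "P = colon R I t"
proof -
  have prime: "primeideal P R" using P by (simp add: height_one_primes_def)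
  have "colon R I \<one> \<inter> (carrier R - P) = {}" using I(3) by (auto simp: colon_def)
  then obtain t where t: "t \<in> carrier R" "primeideal (colon R I (\<one> \<otimes> t)) R"
      "colon R I (\<one> \<otimes> t) \<inter> (carrier R - P) = {}"
    using exists_prime_colon[OF I(1) one_closed submonoid_compl_prime[OF prime]] by blast
  have "colon R I t \<subseteq> P" using t by (auto simp: colon_def)
  moreover have "colon R I t \<noteq> {\<zero>}"
    using colon_superset[OF I(1) t(1)] zero_psubset_ideal[OF I(1,2)] by blast
  ultimately have "colon R I t = P" using height_one_minimal[OF P] t by simp
  with t that show ?thesis by blast
qed

lemma height_one_uniformizer:
  assumes P: "P \<in> height_one_primes R"
  shows "\<exists>p\<in>P. P \<subseteq> saturation R P (PIdl p)"
proof -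
  have prime: "primeideal P R" using P by (simp add: height_one_primes_def)
  interpret P: primeideal P R by fact
  obtain y where y: "y \<in> P" "y \<noteq> \<zero>"
    using height_one_nonzero[OF P] P.zero_closed by blast
  then have yc: "y \<in> carrier R" using P.Icarr by blast
  have "PIdl y \<noteq> {\<zero>}" using cgenideal_self[OF yc] y by blast
  moreover have "PIdl y \<subseteq> P" by (rule cgenideal_minimal[OF P.is_ideal y(1)])
  ultimately obtain z where "z \<in> carrier R" "P = colon R (PIdl y) z"
    using height_one_eq_colon[OF P cgenideal_ideal[OF yc]] by blast
  then show ?thesis using exists_uniformizer_of_colon[OF prime yc y(2)] by blast
qed

text \<open>Nonzero principal ideals have no embedded primes in a normal domain: an associated prime
  has a local generator by \<open>exists_uniformizer_of_colon\<close>, which forces height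
  one.\<close>

lemma colon_PIdl_height_one:
  assumes "primeideal (colon R (PIdl y) z) R" "y \<in> carrier R" "y \<noteq> \<zero>" "z \<in> carrier R"
  shows "colon R (PIdl y) z \<in> height_one_primes R"
proof -
  have "colon R (PIdl y) z \<noteq> {\<zero>}"
    using colon_superset[OF cgenideal_ideal assms(4)] cgenideal_self assms(2,3) by blast
  with exists_uniformizer_of_colon[OF assms refl] height_one_of_uniformizer[OF assms(1)]
  show ?thesis by blast
qed

end

section \<open>The discrete valuation at a height one prime\<close>

definition uniformizer :: "('a, 'b) ring_scheme \<Rightarrow> 'a set \<Rightarrow> 'a" where
  "uniformizer R P = (SOME p. p \<in> P \<and> P \<subseteq> saturation R P (PIdl\<^bsub>R\<^esub> p))"

text \<open>The exponent in a factorization up to elements outside \<open>P\<close>, cleared of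
  denominators. For \<open>x\<close> zero no such exponent exists at a height one prime and the
  value is unspecified; hence the nonzeroness assumptions below.\<close>

definition val :: "('a, 'b) ring_scheme \<Rightarrow> 'a set \<Rightarrow> 'a \<Rightarrow> nat" where
  "val R P x = (THE n. \<exists>u\<in>carrier R - P. \<exists>w\<in>carrier R - P.
     u \<otimes>\<^bsub>R\<^esub> x = w \<otimes>\<^bsub>R\<^esub> uniformizer R P [^]\<^bsub>R\<^esub> n)"

locale height_one_prime = noetherian_normal_domain R + prime: primeideal P R
  for P and R (structure) +
  assumes height_one: "P \<in> height_one_primes R"
begin

abbreviation "\<pi> \<equiv> uniformizer R P"

lemma uniformizer: "\<pi> \<in> P" "P \<subseteq> saturation R P (PIdl \<pi>)"
proof -
  have "\<pi> \<in> P \<and> P \<subseteq> saturation R P (PIdl \<pi>)"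
    unfolding uniformizer_def using someI_ex height_one_uniformizer[OF height_one] by (metis (mono_tags, lifting))
  then show "\<pi> \<in> P" "P \<subseteq> saturation R P (PIdl \<pi>)" by auto
qed

lemma uniformizer_carrier [simp]: "\<pi> \<in> carrier R"
  using uniformizer(1) prime.Icarr by blast

lemma uniformizer_nonzero: "\<pi> \<noteq> \<zero>"
proof
  assume eq: "\<pi> = \<zero>"
  have "x = \<zero>" if xP: "x \<in> P" for x
  proof -
    obtain u c where "u \<in> carrier R - P" "c \<in> carrier R" "u \<otimes> x = c \<otimes> \<zero>"
      using subsetD[OF uniformizer(2) xP] mem_saturation_PIdl[of \<zero>] unfolding eq by blast
    then show ?thesis using integral[of u x] prime.Icarr[OF xP] prime.zero_closed by auto
  qed
  then show False using height_one_nonzero[OF height_one] prime.zero_closed by blast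
qed

lemma uniformizer_pow_nonzero: "\<pi> [^] (n::nat) \<noteq> \<zero>"
  using primeideal_pow_notin[OF zeroprimeideal, of \<pi> n] uniformizer_nonzero by simp

lemma notin_nonzero: "u \<in> carrier R - P \<Longrightarrow> u \<noteq> \<zero>"
  using prime.zero_closed by auto

lemmas mult_notin = primeideal_mult_notin[OF prime.primeideal_axioms]

text \<open>If \<open>n\<close> exceeded \<open>m\<close>, cancelling \<open>\<pi> [^] m\<close> in
  the product of the two equations would put \<open>u \<otimes> w'\<close> into \<open>P\<close>.
  Applied in both directions this makes the exponent unique.\<close>

lemma uniformizer_form_le:
  assumes x: "x \<in> carrier R" and u: "u \<in> carrier R - P" "w \<in> carrier R" "u \<otimes> x = w \<otimes> \<pi> [^] (n::nat)"
    and u': "u' \<in> carrier R" "w' \<in> carrier R - P" "u' \<otimes> x = w' \<otimes> \<pi> [^] (m::nat)"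
  shows "n \<le> m"
proof (rule ccontr)
  assume "\<not> n \<le> m"
  then obtain k where k: "n = m + Suc k" by (metis add_Suc_right less_imp_Suc_add not_le)
  have "\<pi> [^] m \<otimes> (u \<otimes> w') = u \<otimes> (w' \<otimes> \<pi> [^] m)" using u(1,2) u'(1,2) by (simp add: m_ac)
  also have "\<dots> = u' \<otimes> (u \<otimes> x)" unfolding u'(3)[symmetric] using u(1,2) u'(1,2) x by (simp add: m_ac)
  also have "\<dots> = \<pi> [^] m \<otimes> (u' \<otimes> w \<otimes> \<pi> [^] k \<otimes> \<pi>)"
    unfolding u(3) k using u(1,2) u'(1,2) by (simp add: m_ac nat_pow_mult[symmetric])
  finally have "u \<otimes> w' = u' \<otimes> w \<otimes> \<pi> [^] k \<otimes> \<pi>"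
    using u(1,2) u'(1,2) uniformizer_pow_nonzero m_lcancel by simp
  also have "\<dots> \<in> P" using u(1,2) u'(1,2) by (intro prime.I_l_closed uniformizer) simp
  finally show False using mult_notin[OF u(1) u'(2)] by simp
qed

lemma val_eqI:
  assumes "x \<in> carrier R" "u \<in> carrier R - P" "w \<in> carrier R - P" "u \<otimes> x = w \<otimes> \<pi> [^] (n::nat)"
  shows "val R P x = n"
  unfolding val_def
proof (rule the_equality)
  show "\<exists>u\<in>carrier R - P. \<exists>w\<in>carrier R - P. u \<otimes> x = w \<otimes> \<pi> [^] n" using assms by blast
  fix m :: nat assume "\<exists>u\<in>carrier R - P. \<exists>w\<in>carrier R - P. u \<otimes> x = w \<otimes> \<pi> [^] m"
  then obtain u' w' where *: "u' \<in> carrier R - P" "w' \<in> carrier R - P" "u' \<otimes> x = w' \<otimes> \<pi> [^] m" by blast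
  show "m = n"
    using uniformizer_form_le[OF assms(1) * (1) _ *(3) _ assms(3,4)]
      uniformizer_form_le[OF assms(1,2) _ assms(4) _ *(2,3)] assms * by auto
qed

lemma val_form:
  assumes "x \<in> carrier R" "x \<noteq> \<zero>"
  obtains u w where "u \<in> carrier R - P" "w \<in> carrier R - P" "u \<otimes> x = w \<otimes> \<pi> [^] val R P x"
proof -
  obtain n u w where *: "u \<in> carrier R - P" "w \<in> carrier R - P" "u \<otimes> x = w \<otimes> \<pi> [^] (n::nat)"
    using uniformizer_form[OF prime.primeideal_axioms uniformizer assms] by blast
  with val_eqI[OF assms(1) *] that show ?thesis by blast
qed

lemma val_mult:
  assumes "x \<in> carrier R" "x \<noteq> \<zero>" "y \<in> carrier R" "y \<noteq> \<zero>"
  shows "val R P (x \<otimes> y) = val R P x + val R P y"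
proof -
  obtain u w where u: "u \<in> carrier R - P" "w \<in> carrier R - P" "u \<otimes> x = w \<otimes> \<pi> [^] val R P x"
    using val_form[OF assms(1,2)] .
  obtain u' w' where u': "u' \<in> carrier R - P" "w' \<in> carrier R - P" "u' \<otimes> y = w' \<otimes> \<pi> [^] val R P y"
    using val_form[OF assms(3,4)] .
  have "(u \<otimes> u') \<otimes> (x \<otimes> y) = (u \<otimes> x) \<otimes> (u' \<otimes> y)" using assms u(1,2) u'(1,2) by (simp add: m_ac)
  also have "\<dots> = (w \<otimes> w') \<otimes> \<pi> [^] (val R P x + val R P y)"
    unfolding u(3) u'(3) using u(1,2) u'(1,2) by (simp add: m_ac nat_pow_mult[symmetric])
  finally show ?thesis
    using assms mult_notin[OF u(1) u'(1)] mult_notin[OF u(2) u'(2)]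
    by (intro val_eqI[of _ "u \<otimes> u'" "w \<otimes> w'"]) simp_all
qed

lemma val_notin: "x \<in> carrier R - P \<Longrightarrow> val R P x = 0"
  using prime.primeideal_axioms primeideal_one_notin
  by (intro val_eqI[of _ \<one> x]) auto

lemma val_pow:
  assumes "x \<in> carrier R" "x \<noteq> \<zero>"
  shows "val R P (x [^] (n::nat)) = n * val R P x"
proof (induction n)
  case 0
  then show ?case using val_notin[of \<one>] primeideal_one_notin[OF prime.primeideal_axioms] by simp
next
  case (Suc n)
  have "x [^] n \<noteq> \<zero>" using primeideal_pow_notin[OF zeroprimeideal, of x n] assms by simp
  with Suc assms show ?case by (simp add: val_mult)
qed

lemma val_uniformizer: "val R P \<pi> = 1"
  using primeideal_one_notin[OF prime.primeideal_axioms] by (intro val_eqI[of _ \<one> \<one>]) auto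

text \<open>The translation between multipliers and numbers: both elements are powers of
  \<open>\<pi>\<close> up to factors outside \<open>P\<close>, so divisibility at \<open>P\<close>
  compares exponents.\<close>

lemma mem_saturation_PIdl_iff_val:
  assumes x: "x \<in> carrier R" "x \<noteq> \<zero>" and y: "y \<in> carrier R" "y \<noteq> \<zero>"
  shows "x \<in> saturation R P (PIdl y) \<longleftrightarrow> val R P y \<le> val R P x"
proof
  assume "x \<in> saturation R P (PIdl y)"
  then obtain u c where u: "u \<in> carrier R - P" "c \<in> carrier R" "u \<otimes> x = c \<otimes> y"
    using mem_saturation_PIdl[OF y(1)] by auto
  then have "c \<noteq> \<zero>" using integral[of u x] notin_nonzero x y by auto
  then have "val R P u + val R P x = val R P c + val R P y"
    using u x y notin_nonzero val_mult[of u x] val_mult[of c y] by simp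
  then show "val R P y \<le> val R P x" using val_notin[OF u(1)] by simp
next
  assume "val R P y \<le> val R P x"
  then obtain k where k: "val R P x = val R P y + k" using le_Suc_ex by blast
  obtain u w where u: "u \<in> carrier R - P" "w \<in> carrier R - P" "u \<otimes> x = w \<otimes> \<pi> [^] val R P x"
    using val_form[OF x] .
  obtain u' w' where u': "u' \<in> carrier R - P" "w' \<in> carrier R - P" "u' \<otimes> y = w' \<otimes> \<pi> [^] val R P y"
    using val_form[OF y] .
  have "(w' \<otimes> u) \<otimes> x = w' \<otimes> (u \<otimes> x)" using u(1,2) u'(1,2) x by (simp add: m_assoc)
  also have "\<dots> = w \<otimes> \<pi> [^] k \<otimes> (w' \<otimes> \<pi> [^] val R P y)"
    unfolding u(3) k using u(1,2) u'(1,2) by (simp add: m_ac nat_pow_mult[symmetric])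
  also have "\<dots> = (w \<otimes> \<pi> [^] k \<otimes> u') \<otimes> y"
    unfolding u'(3)[symmetric] using u(1,2) u'(1,2) y by (simp add: m_ac)
  finally show "x \<in> saturation R P (PIdl y)"
    using mult_notin[OF u'(2) u(1)] u(2) u'(1) x unfolding mem_saturation_PIdl[OF y(1)]
    by (meson DiffD1 m_closed nat_pow_closed uniformizer_carrier)
qed

lemma val_pos: "x \<in> P \<Longrightarrow> x \<noteq> \<zero> \<Longrightarrow> 1 \<le> val R P x"
  using mem_saturation_PIdl_iff_val[of x \<pi>] prime.Icarr uniformizer uniformizer_nonzero val_uniformizer
  by auto

lemma val_le_mult:
  assumes "x \<in> carrier R" "x \<noteq> \<zero>" "x \<in> PIdl y" "y \<in> carrier R"
  shows "y \<noteq> \<zero> \<and> val R P y \<le> val R P x"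
proof -
  obtain c where "c \<in> carrier R" "x = c \<otimes> y" using assms by (auto simp: cgenideal_def)
  then show ?thesis using assms val_mult[of c y] by (cases "c = \<zero>"; cases "y = \<zero>") auto
qed

text \<open>In a discrete valuation ring an element of least value generates the ideal. Zero is
  treated separately because it has no value.\<close>

lemma subset_saturation_least_val:
  assumes I: "ideal I R" and e: "e \<in> I" "e \<noteq> \<zero>"
    and least: "\<And>x. x \<in> I \<Longrightarrow> x \<noteq> \<zero> \<Longrightarrow> val R P e \<le> val R P x"
  shows "I \<subseteq> saturation R P (PIdl e)"
proof
  interpret I: ideal I R by fact
  have ec: "e \<in> carrier R" using e I.Icarr by blast
  fix x assume x: "x \<in> I"
  show "x \<in> saturation R P (PIdl e)"
  proof (cases "x = \<zero>")
    case True
    then show ?thesis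
      using additive_subgroup.zero_closed[OF ideal.axioms(1)[OF
          saturation_ideal[OF prime.primeideal_axioms cgenideal_ideal[OF ec]]]] by simp
  next
    case False
    then show ?thesis using mem_saturation_PIdl_iff_val[of x e] x e ec least I.Icarr by blast
  qed
qed

end

section \<open>Powers of an ideal with a local generator\<close>

context cring
begin

lemma mult_interchange:
  assumes "a \<in> carrier R" "b \<in> carrier R" "c \<in> carrier R" "d \<in> carrier R"
  shows "(a \<otimes> b) \<otimes> (c \<otimes> d) = (a \<otimes> c) \<otimes> (b \<otimes> d)"
  using assms by (simp add: m_ac)

lemma ideal_power_subset_saturation:
  assumes P: "primeideal P R" and I: "ideal I R" and e: "e \<in> carrier R" and sub: "I \<subseteq> saturation R P (PIdl e)"
  shows "ideal_power R I n \<subseteq> saturation R P (PIdl (e [^] n))"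
proof (induction n)
  case 0
  have "PIdl \<one> = carrier R" 
    using ideal.one_imp_carrier[OF cgenideal_ideal cgenideal_self] by simp
  then show ?case
    unfolding ideal_power_0 using subset_saturation[OF P, of "carrier R"] by simp
next
  case (Suc n)
  interpret S: ideal "saturation R P (PIdl (e [^] Suc n))" R
    by (intro saturation_ideal P cgenideal_ideal nat_pow_closed e)
  show ?case
  proof
    fix x assume "x \<in> ideal_power R I (Suc n)"
    then have "x \<in> ideal_prod R (ideal_power R I n) I" unfolding ideal_power_Suc .
    then show "x \<in> saturation R P (PIdl (e [^] Suc n))"
    proof (induction rule: ideal_prod.induct)
      case (prod i j)
      have "i \<in> saturation R P (PIdl (e [^] n))" using prod(1) Suc by blast
      then obtain u c where u: "u \<in> carrier R - P" "c \<in> carrier R" "i \<in> carrier R" "u \<otimes> i = c \<otimes> e [^] n"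
        unfolding mem_saturation_PIdl[OF nat_pow_closed[OF e]] by blast
      have "j \<in> saturation R P (PIdl e)" using prod(2) sub by blast
      then obtain v d where v: "v \<in> carrier R - P" "d \<in> carrier R" "j \<in> carrier R" "v \<otimes> j = d \<otimes> e"
        unfolding mem_saturation_PIdl[OF e] by blast
      have uv: "u \<in> carrier R" "v \<in> carrier R" using u(1) v(1) by auto
      have "(u \<otimes> v) \<otimes> (i \<otimes> j) = (u \<otimes> i) \<otimes> (v \<otimes> j)"
        using uv u(3) v(3) by (rule mult_interchange)
      also have "\<dots> = (c \<otimes> d) \<otimes> (e [^] n \<otimes> e)"
        unfolding u(4) v(4) using u(2) nat_pow_closed[OF e] v(2) e by (rule mult_interchange)
      also have "e [^] n \<otimes> e = e [^] Suc n" by simp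
      finally have "(u \<otimes> v) \<otimes> (i \<otimes> j) = (c \<otimes> d) \<otimes> e [^] Suc n" .
      moreover have "c \<otimes> d \<in> carrier R" "i \<otimes> j \<in> carrier R" using u(2,3) v(2,3) by simp_all
      ultimately show ?case
        using primeideal_mult_notin[OF P u(1) v(1)]
        unfolding mem_saturation_PIdl[OF nat_pow_closed[OF e]] by blast
    qed (rule S.a_closed)
  qed
qed

end

context height_one_prime
begin

text \<open>Since \<open>\<pi>\<close> generates \<open>P\<close> locally, the saturation of the
  power of \<open>P\<close> is that of the ideal of \<open>\<pi> [^] n\<close>, and
  \<open>\<pi>\<close> has value one.\<close>

lemma mem_symbolic_power_iff_val:
  assumes "x \<in> carrier R" "x \<noteq> \<zero>"
  shows "x \<in> symbolic_power R P n \<longleftrightarrow> n \<le> val R P x"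
proof -
  note prime = prime.primeideal_axioms
  have "ideal_power R P n \<subseteq> saturation R P (PIdl (\<pi> [^] n))"
    by (rule ideal_power_subset_saturation[OF prime prime.is_ideal _ uniformizer(2)]) simp
  then have "saturation R P (ideal_power R P n) \<subseteq> saturation R P (PIdl (\<pi> [^] n))"
    by (rule saturation_subset_saturation[OF prime])
  moreover have "PIdl (\<pi> [^] n) \<subseteq> ideal_power R P n"
    by (intro cgenideal_minimal ideal_power_ideal prime.is_ideal pow_mem_ideal_power uniformizer)
  ultimately have "symbolic_power R P n = saturation R P (PIdl (\<pi> [^] n))"
    using symbolic_power_prime[OF prime] saturation_mono by blast
  then show ?thesis
    using mem_saturation_PIdl_iff_val[OF assms, of "\<pi> [^] n"] uniformizer_pow_nonzero
    by (simp add: val_pow uniformizer_nonzero val_uniformizer)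
qed

end

section \<open>Divisors\<close>

context noetherian_normal_domain
begin

abbreviation "height_ones \<equiv> height_one_primes R"

lemma height_one_primeI: "P \<in> height_ones \<Longrightarrow> height_one_prime P R"
  by (simp add: height_one_prime_def height_one_prime_axioms_def noetherian_normal_domain_axioms
      height_one_primes_def)

text \<open>The ring is the intersection of its valuation rings at height one primes, stated for the
  fraction \<open>x / y\<close>: membership is tested at the associated primes of the ideal of
  \<open>y\<close>, and \<open>colon_PIdl_height_one\<close> gives them height one.\<close>

lemma mem_PIdl_iff_val:
  assumes x: "x \<in> carrier R" "x \<noteq> \<zero>" and y: "y \<in> carrier R" "y \<noteq> \<zero>"
  shows "x \<in> PIdl y \<longleftrightarrow> (\<forall>P\<in>height_ones. val R P y \<le> val R P x)"
proof
  assume "x \<in> PIdl y"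
  then show "\<forall>P\<in>height_ones. val R P y \<le> val R P x"
    using height_one_prime.val_le_mult[OF height_one_primeI x _ y(1)] by blast
next
  assume le: "\<forall>P\<in>height_ones. val R P y \<le> val R P x"
  show "x \<in> PIdl y"
  proof (rule mem_ideal_if_locally[OF cgenideal_ideal[OF y(1)] x(1)])
    fix P t assume P: "primeideal P R" "t \<in> carrier R" "P = colon R (PIdl y) t"
    then have "P \<in> height_ones" using colon_PIdl_height_one[of y t] y by simp
    then show "x \<in> saturation R P (PIdl y)"
      using le height_one_prime.mem_saturation_PIdl_iff_val[OF height_one_primeI x y] by blast
  qed
qed

lemma prod_nonzero: "x \<in> carrier R \<Longrightarrow> x \<noteq> \<zero> \<Longrightarrow> y \<in> carrier R \<Longrightarrow> y \<noteq> \<zero> \<Longrightarrow> x \<otimes> y \<noteq> \<zero>"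
  using integral by blast

lemma pow_nonzero: "x \<in> carrier R \<Longrightarrow> x \<noteq> \<zero> \<Longrightarrow> x [^] (n::nat) \<noteq> \<zero>"
  using primeideal_pow_notin[OF zeroprimeideal, of x n] by simp

text \<open>A one-sided approximation: multiply, over \<open>Q\<close> in \<open>U\<close>, the
  power of exponent \<open>n Q\<close> of an element of \<open>Q\<close> outside \<open>P\<close>.
  Each factor has value at least one at its own prime before taking the power, and values at the
  others only grow.\<close>

lemma exists_large_val_avoiding:
  assumes "finite U" "U \<subseteq> height_ones" "primeideal P R" "\<And>Q. Q \<in> U \<Longrightarrow> \<not> Q \<subseteq> P"
  shows "\<exists>g\<in>carrier R - P. \<forall>Q\<in>U. n Q \<le> val R Q g"
  using assms
proof (induction U)
  case empty
  then show ?case using primeideal_one_notin by auto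
next
  case (insert Q U)
  then obtain g where g: "g \<in> carrier R - P" "\<forall>Q\<in>U. n Q \<le> val R Q g" by auto
  obtain e where e: "e \<in> Q" "e \<notin> P" using insert.prems(3)[of Q] by auto
  interpret P: primeideal P R by fact
  interpret Q: height_one_prime Q R by (rule height_one_primeI) (use insert.prems(1) in simp)
  have ec: "e \<in> carrier R" using e Q.prime.Icarr by blast
  have en: "e [^] n Q \<in> carrier R - P" using primeideal_pow_notin[OF insert.prems(2)] ec e by blast
  have nz: "e \<noteq> \<zero>" "e [^] n Q \<noteq> \<zero>" "g \<noteq> \<zero>" using e(2) en g(1) P.zero_closed by auto
  have "n Q' \<le> val R Q' (g \<otimes> e [^] n Q)" if "Q' \<in> insert Q U" for Q'
  proof -
    interpret Q': height_one_prime Q' R by (rule height_one_primeI) (use insert.prems(1) that in auto)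
    have "val R Q' (g \<otimes> e [^] n Q) = val R Q' g + n Q * val R Q' e"
      using g(1) nz ec by (simp add: Q'.val_mult Q'.val_pow)
    moreover have "n Q \<le> n Q * val R Q e" using Q.val_pos[OF e(1) nz(1)] by simp
    moreover have "n Q' \<le> val R Q' g" if "Q' \<noteq> Q"
      using that \<open>Q' \<in> insert Q U\<close> g(2) by simp
    ultimately show ?thesis
      by (cases "Q' = Q") (simp_all only: trans_le_add1 trans_le_add2 not_False_eq_True simp_thms)
  qed
  then show ?case by (intro bexI[OF _ primeideal_mult_notin[OF insert.prems(2) g(1) en]] ballI)
qed

text \<open>The generator \<open>f\<close> has at least the prescribed values because it lies in the
  intersection \<open>A\<close>. It has no larger ones because \<open>A\<close> contains, for each
  \<open>P\<close>, an element with exactly the prescribed value at \<open>P\<close>, and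
  \<open>f\<close> divides it. Primes outside the support are included, with value zero.\<close>

lemma principal_divisor_val:
  assumes "c \<in> principal_divisors R"
  shows "\<exists>f\<in>carrier R - {\<zero>}. \<forall>P\<in>height_ones. Poly_Mapping.lookup c P = int (val R P f)"
proof -
  define n where "n = (\<lambda>P. nat (Poly_Mapping.lookup c P))"
  define A where "A = carrier R \<inter> (\<Inter>P\<in>Poly_Mapping.keys c. symbolic_power R P (n P))"
  have keys: "Poly_Mapping.keys c \<subseteq> height_ones" and A: "principalideal A R"
    and pos: "\<And>P. P \<in> Poly_Mapping.keys c \<Longrightarrow> Poly_Mapping.lookup c P > 0"
    using assms by (auto simp: principal_divisors_def A_def n_def)
  interpret A: principalideal A R by (rule A)
  obtain f where f: "f \<in> carrier R" "A = PIdl f"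
    using A.generate cgenideal_eq_genideal by auto
  have mem_A: "x \<in> A \<longleftrightarrow> (\<forall>P\<in>Poly_Mapping.keys c. n P \<le> val R P x)"
    if "x \<in> carrier R" "x \<noteq> \<zero>" for x
    using that keys height_one_prime.mem_symbolic_power_iff_val[OF height_one_primeI that]
    by (auto simp: A_def)
  have f0: "f \<noteq> \<zero>"
  proof -
    \<comment> \<open>Avoiding the zero ideal produces a nonzero element of \<open>A\<close>, so the
      generator of \<open>A\<close> is nonzero.\<close>
    obtain g where g: "g \<in> carrier R - {\<zero>}" "\<forall>Q\<in>Poly_Mapping.keys c. n Q \<le> val R Q g"
    proof -
      have "\<not> Q \<subseteq> {\<zero>}" if "Q \<in> Poly_Mapping.keys c" for Q
        using that keys height_one_nonzero[of Q] zero_psubset_ideal[OF primeideal.axioms(1), of Q]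
        by (auto simp: height_one_primes_def)
      then show ?thesis
        using exists_large_val_avoiding[OF finite_keys keys zeroprimeideal] that by blast
    qed
    then have "g \<in> A" using mem_A[of g] by simp
    then obtain s where "s \<in> carrier R" "g = s \<otimes> f" unfolding f(2) cgenideal_def by blast
    then show ?thesis using g(1) by auto
  qed
  have "Poly_Mapping.lookup c P = int (val R P f)" if P: "P \<in> height_ones" for P
  proof -
    interpret P: height_one_prime P R by (rule height_one_primeI[OF P])
    have "\<not> Q \<subseteq> P" if "Q \<in> Poly_Mapping.keys c - {P}" for Q
      using that keys height_one_minimal[OF P, of Q] height_one_nonzero[of Q]
      by (auto simp: height_one_primes_def)
    then obtain g where g: "g \<in> carrier R - P" "\<forall>Q\<in>Poly_Mapping.keys c - {P}. n Q \<le> val R Q g"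
      using exists_large_val_avoiding[of "Poly_Mapping.keys c - {P}" P n] keys P.prime.primeideal_axioms
      by auto
    \<comment> \<open>\<open>g\<close> has value zero at \<open>P\<close> and is large at the other
      primes of the support, so the power of the uniformizer fixes the value at \<open>P\<close>
      without leaving \<open>A\<close>.\<close>
    define h where "h = g \<otimes> P.\<pi> [^] n P"
    have h: "h \<in> carrier R" "h \<noteq> \<zero>"
      using g(1) P.notin_nonzero P.uniformizer_pow_nonzero prod_nonzero by (auto simp: h_def)
    have val_h: "val R Q h = val R Q g + n P * val R Q P.\<pi>" if "Q \<in> height_ones" for Q
    proof -
      interpret Q: height_one_prime Q R by (rule height_one_primeI[OF that])
      show ?thesis
        using g(1) P.notin_nonzero P.uniformizer_nonzero P.uniformizer_pow_nonzero
        by (simp add: h_def Q.val_mult Q.val_pow)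
    qed
    have vP: "val R P h = n P" using val_h[OF P] P.val_notin[OF g(1)] P.val_uniformizer by simp
    have "h \<in> A"
      unfolding mem_A[OF h]
    proof
      fix Q assume Q: "Q \<in> Poly_Mapping.keys c"
      show "n Q \<le> val R Q h"
      proof (cases "Q = P")
        case False
        then have "n Q \<le> val R Q g" "Q \<in> height_ones" using Q g(2) keys by auto
        then show ?thesis using val_h[of Q] by simp
      qed (simp add: vP)
    qed
    then have "val R P f \<le> n P" using P.val_le_mult[OF h _ f(1)] vP f(2) by simp
    moreover have "n P \<le> val R P f"
    proof (cases "P \<in> Poly_Mapping.keys c")
      case True
      moreover have "f \<in> A" unfolding f(2) by (rule cgenideal_self[OF f(1)])
      ultimately show ?thesis using mem_A[OF f(1) f0] by simp
    next
      case False
      then show ?thesis by (simp add: n_def in_keys_iff)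
    qed
    moreover have "int (n P) = Poly_Mapping.lookup c P"
      using pos[of P] by (cases "P \<in> Poly_Mapping.keys c") (auto simp: n_def in_keys_iff)
    ultimately show ?thesis by simp
  qed
  then show ?thesis using f f0 by blast
qed

text \<open>The trivial classes are divisors of fractions \<open>f / g\<close>: a generator has
  denominator one, an inverse exchanges \<open>f\<close> and \<open>g\<close>, and the group
  operation multiplies fractions.\<close>

lemma principal_class_val:
  assumes "c \<in> generate (free_Abelian_group height_ones) (principal_divisors R)"
  shows "\<exists>f\<in>carrier R - {\<zero>}. \<exists>g\<in>carrier R - {\<zero>}. \<forall>P\<in>height_ones.
           Poly_Mapping.lookup c P = int (val R P f) - int (val R P g)"
  using assms
proof (induction rule: generate.induct)
  case one
  have "\<one> \<in> carrier R - {\<zero>}" by simp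
  then show ?case by (fastforce simp: lookup_zero)
next
  case (incl h)
  then obtain f where f: "f \<in> carrier R - {\<zero>}" "\<forall>P\<in>height_ones. Poly_Mapping.lookup h P = int (val R P f)"
    using principal_divisor_val by blast
  have "val R P \<one> = 0" if "P \<in> height_ones" for P
    using height_one_prime.val_notin[OF height_one_primeI[OF that], of \<one>] that primeideal_one_notin
    by (auto simp: height_one_primes_def)
  then show ?case using f by (intro bexI[of _ f] bexI[of _ \<one>]) auto
next
  case (inv h)
  then obtain f where f: "f \<in> carrier R - {\<zero>}" "\<forall>P\<in>height_ones. Poly_Mapping.lookup h P = int (val R P f)"
    using principal_divisor_val by blast
  have "val R P \<one> = 0" if "P \<in> height_ones" for P
    using height_one_prime.val_notin[OF height_one_primeI[OF that], of \<one>] that primeideal_one_notin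
    by (auto simp: height_one_primes_def)
  moreover have "inv\<^bsub>free_Abelian_group height_ones\<^esub> h = - h"
    using inv by (intro inv_free_Abelian_group) (auto simp: principal_divisors_def)
  ultimately show ?case using f by (intro bexI[of _ \<one>] bexI[of _ f]) auto
next
  case (eng h1 h2)
  obtain f g where 1: "f \<in> carrier R - {\<zero>}" "g \<in> carrier R - {\<zero>}"
      "\<forall>P\<in>height_ones. Poly_Mapping.lookup h1 P = int (val R P f) - int (val R P g)"
    using eng.IH(1) by blast
  obtain f' g' where 2: "f' \<in> carrier R - {\<zero>}" "g' \<in> carrier R - {\<zero>}"
      "\<forall>P\<in>height_ones. Poly_Mapping.lookup h2 P = int (val R P f') - int (val R P g')"
    using eng.IH(2) by blast
  note * = 1(1,2) 2(1,2) 1(3) 2(3)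
  have "val R P (x \<otimes> y) = val R P x + val R P y"
    if "P \<in> height_ones" "x \<in> carrier R - {\<zero>}" "y \<in> carrier R - {\<zero>}" for P x y
    using height_one_prime.val_mult[OF height_one_primeI[OF that(1)]] that by simp
  then have "Poly_Mapping.lookup (h1 + h2) P = int (val R P (f \<otimes> f')) - int (val R P (g \<otimes> g'))"
    if "P \<in> height_ones" for P
    using that *(1-4) *(5,6)[rule_format, OF that] by (simp add: lookup_add)
  moreover have "f \<otimes> f' \<in> carrier R - {\<zero>}" "g \<otimes> g' \<in> carrier R - {\<zero>}"
    using *(1-4) prod_nonzero[of f f'] prod_nonzero[of g g'] by auto
  ultimately show ?case unfolding mult_free_Abelian_group by blast
qed

text \<open>The conclusion avoids values so that it can be applied after localizing. An
  \<open>e\<close> in \<open>I\<close> whose saturation contains \<open>I\<close> is a local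
  generator of \<open>I\<close> at \<open>P\<close>, so the condition on \<open>x\<close> says that
  \<open>x\<close> lies in the power \<open>D * n\<close> of \<open>I\<close> at every height one
  prime containing \<open>I\<close>.\<close>

lemma exists_generator_of_multiple:
  fixes D :: nat
  assumes D: "D > 0"
    and kill: "\<forall>x\<in>carrier (class_group R). x [^]\<^bsub>class_group R\<^esub> D = \<one>\<^bsub>class_group R\<^esub>"
    and I: "ideal I R" "I \<noteq> {\<zero>}"
    and pure: "\<And>P t. primeideal P R \<Longrightarrow> t \<in> carrier R \<Longrightarrow> P = colon R I t \<Longrightarrow> P \<in> height_ones"
  shows "\<exists>h\<in>I. \<forall>x\<in>carrier R. \<forall>n.
    (\<forall>P\<in>height_ones. I \<subseteq> P \<longrightarrow> (\<forall>e\<in>I. I \<subseteq> saturation R P (PIdl e) \<longrightarrow>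
        x \<in> saturation R P (PIdl (e [^] (D * n))))) \<longrightarrow> x \<in> PIdl (h [^] n)"
proof -
  interpret I: ideal I R by fact
  define a where "a = (\<lambda>P. LEAST k. \<exists>x\<in>I. x \<noteq> \<zero> \<and> val R P x = k)"
  have le_a: "a P \<le> val R P x" if "x \<in> I" "x \<noteq> \<zero>" for P x
    unfolding a_def using that by (intro Least_le) auto
  have "\<exists>e\<in>I. e \<noteq> \<zero> \<and> val R P e = a P" for P
  proof -
    obtain x where "x \<in> I" "x \<noteq> \<zero>" using zero_psubset_ideal[OF I] by blast
    then have "\<exists>k. \<exists>x\<in>I. x \<noteq> \<zero> \<and> val R P x = k" by blast
    from LeastI_ex[OF this] show ?thesis unfolding a_def .
  qed
  then obtain e where e: "e P \<in> I" "e P \<noteq> \<zero>" "val R P (e P) = a P" for P by metis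
  have ec: "e P \<in> carrier R" for P using e I.Icarr by blast
  define T where "T = {P \<in> height_ones. I \<subseteq> P}"
  have "finite T"
  proof (rule finite_incomparable_associated_primes[OF I(1)])
    fix P assume "P \<in> T"
    then show "primeideal P R \<and> (\<exists>t\<in>carrier R. P = colon R I t)"
      using height_one_eq_colon[OF _ I, of P] by (auto simp: T_def height_one_primes_def)
  next
    fix P Q assume "P \<in> T" "Q \<in> T" "P \<subseteq> Q"
    then show "P = Q" using height_one_minimal[of Q P] height_one_nonzero[of P]
      by (auto simp: T_def height_one_primes_def)
  qed
  \<comment> \<open>The divisor of \<open>I\<close>, with the least values as coefficients.
    Finiteness of \<open>T\<close> is what makes it a formal sum; dropping the primes outside
    \<open>T\<close> changes nothing, because there \<open>I\<close> contains an element outside the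
    prime and \<open>a\<close> vanishes.\<close>
  define c where "c = Abs_poly_mapping (\<lambda>P. if P \<in> T then int (a P) else 0)"
  have lookup: "Poly_Mapping.lookup c = (\<lambda>P. if P \<in> T then int (a P) else 0)"
    unfolding c_def using \<open>finite T\<close> by (intro Abs_poly_mapping_inverse) (auto elim: rev_finite_subset)
  have a0: "a P = 0" if P: "P \<in> height_ones" "P \<notin> T" for P
  proof -
    interpret P: height_one_prime P R by (rule height_one_primeI[OF P(1)])
    obtain x where x: "x \<in> I" "x \<notin> P" using P by (auto simp: T_def)
    then have "x \<noteq> \<zero>" using P.prime.zero_closed by auto
    then show ?thesis using le_a[OF x(1), of P] P.val_notin[of x] x I.Icarr by auto
  qed
  have keys: "Poly_Mapping.keys c \<subseteq> height_ones"
    by (auto simp: in_keys_iff lookup T_def split: if_splits)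
  define F where "F = free_Abelian_group height_ones"
  define N where "N = generate F (principal_divisors R)"
  interpret F: comm_group F unfolding F_def by (rule abelian_free_Abelian_group)
  have "principal_divisors R \<subseteq> carrier F" by (auto simp: principal_divisors_def F_def)
  then have "subgroup N F" unfolding N_def by (rule F.generate_is_subgroup)
  then interpret N: normal N F by (rule F.subgroup_imp_normal)
  have cF: "c \<in> carrier F" using keys by (simp add: F_def)
  \<comment> \<open>The group is written multiplicatively: the power \<open>D\<close> of the class
    of \<open>c\<close> is trivial, so \<open>D\<close> times the divisor lies in the subgroup
    \<open>N\<close> of relations.\<close>
  have "(N #>\<^bsub>F\<^esub> c) [^]\<^bsub>F Mod N\<^esub> D = N"
    using kill cF by (auto simp: class_group_def Let_def F_def[symmetric] N_def[symmetric] carrier_FactGroup)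
  then have "N #>\<^bsub>F\<^esub> (c [^]\<^bsub>F\<^esub> D) = N" using N.FactGroup_pow[OF cF] by simp
  then have "c [^]\<^bsub>F\<^esub> D \<in> N" using F.rcos_self[OF _ \<open>subgroup N F\<close>] cF by (metis F.nat_pow_closed)
  then have "frag_cmul (int D) c \<in> N" by (simp add: F_def)
  then obtain f g where fg: "f \<in> carrier R - {\<zero>}" "g \<in> carrier R - {\<zero>}"
    "\<forall>P\<in>height_ones. Poly_Mapping.lookup (frag_cmul (int D) c) P = int (val R P f) - int (val R P g)"
    using principal_class_val unfolding N_def F_def by blast
  have vfg: "val R P f = D * a P + val R P g" if "P \<in> height_ones" for P
  proof -
    have "int (val R P f) - int (val R P g) = int D * int (a P)"
      using fg(3) that a0[OF that] by (auto simp: lookup split: if_splits)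
    then have "int (val R P f) = int (D * a P + val R P g)" by simp
    then show ?thesis by (simp only: of_nat_eq_iff)
  qed
  \<comment> \<open>All values of \<open>f / g\<close> are \<open>D * a P\<close>, hence
    nonnegative, so the fraction is a ring element.\<close>
  then have "f \<in> PIdl g" using mem_PIdl_iff_val[of f g] fg by simp
  then obtain h where h: "h \<in> carrier R" "f = h \<otimes> g" by (auto simp: cgenideal_def)
  then have h0: "h \<noteq> \<zero>" using fg by auto
  have vh: "val R P h = D * a P" if "P \<in> height_ones" for P
    using vfg[OF that] height_one_prime.val_mult[OF height_one_primeI[OF that] h(1) h0, of g] fg(2) h(2)
    by simp
  have sat: "I \<subseteq> saturation R P (PIdl (e P))" if "P \<in> height_ones" for P
    using height_one_prime.subset_saturation_least_val[OF height_one_primeI[OF that] I(1) e(1,2)] le_a e(3)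
    by auto
  have "h \<in> I"
  proof (rule mem_ideal_if_locally[OF I(1) h(1)])
    fix P t assume P: "primeideal P R" "t \<in> carrier R" "P = colon R I t"
    then have ht: "P \<in> height_ones" by (rule pure)
    have "a P \<le> D * a P" using D by simp
    then have "h \<in> saturation R P (PIdl (e P))"
      using height_one_prime.mem_saturation_PIdl_iff_val[OF height_one_primeI[OF ht] h(1) h0 ec e(2)] vh[OF ht] e(3)
      by simp
    moreover have "PIdl (e P) \<subseteq> I" by (rule cgenideal_minimal[OF I(1) e(1)])
    ultimately show "h \<in> saturation R P I" using saturation_mono by blast
  qed
  moreover have "x \<in> PIdl (h [^] n)"
    if x: "x \<in> carrier R" and loc: "\<forall>P\<in>height_ones. I \<subseteq> P \<longrightarrow> (\<forall>e\<in>I. I \<subseteq> saturation R P (PIdl e) \<longrightarrow>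
        x \<in> saturation R P (PIdl (e [^] (D * n))))" for x n
  proof (cases "x = \<zero>")
    case True
    then show ?thesis
      using additive_subgroup.zero_closed[OF ideal.axioms(1)[OF cgenideal_ideal[OF nat_pow_closed[OF h(1)]]]]
      by simp
  next
    case False
    have "val R P (h [^] n) \<le> val R P x" if P: "P \<in> height_ones" for P
    proof -
      interpret P: height_one_prime P R by (rule height_one_primeI[OF P])
      have v: "val R P (h [^] n) = D * n * a P" using P.val_pow[OF h(1) h0] vh[OF P] by simp
      show ?thesis
      proof (cases "I \<subseteq> P")
        case True
        then have "x \<in> saturation R P (PIdl (e P [^] (D * n)))" using loc P e(1) sat[OF P] by blast
        then have "val R P (e P [^] (D * n)) \<le> val R P x"
          using P.mem_saturation_PIdl_iff_val[OF x False nat_pow_closed[OF ec] pow_nonzero[OF ec e(2)]] by blast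
        then show ?thesis using v P.val_pow[OF ec e(2)] e(3) by simp
      next
        case False
        then show ?thesis using v a0[OF P] P by (simp add: T_def)
      qed
    qed
    then show ?thesis using mem_PIdl_iff_val[OF x False nat_pow_closed[OF h(1)] pow_nonzero[OF h(1) h0]] by blast
  qed
  ultimately show ?thesis by blast
qed

end

section \<open>Passing to the localizations\<close>

lemma (in ring_hom_ring) image_ideal_power:
  assumes R: "cring R" and S: "cring S" and I: "ideal I R" and J: "h ` I \<subseteq> J"
  shows "h ` ideal_power R I n \<subseteq> ideal_power S J n"
proof (induction n)
  case 0
  show ?case unfolding cring.ideal_power_0[OF R] cring.ideal_power_0[OF S] by auto
next
  case (Suc n)
  have "h x \<in> ideal_prod S (ideal_power S J n) J" if "x \<in> ideal_prod R (ideal_power R I n) I" for x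
    using that
  proof (induction rule: ideal_prod.induct)
    case (prod i j)
    then have "i \<in> carrier R" "j \<in> carrier R" "h i \<in> ideal_power S J n" "h j \<in> J"
      using ideal.Icarr[OF I] ideal.Icarr[OF cring.ideal_power_ideal[OF R I]] Suc J by blast+
    then show ?case using ideal_prod.prod[of "h i" _ "h j"] by simp
  next
    case (sum s1 s2)
    note Icarr = ideal.Icarr[OF R.ideal_prod_is_ideal[OF cring.ideal_power_ideal[OF R I] I]]
    have "s1 \<in> carrier R" "s2 \<in> carrier R" by (rule Icarr[OF sum(1)], rule Icarr[OF sum(2)])
    then show ?case using ideal_prod.sum[OF sum(3,4)] by simp
  qed
  then show ?case
    unfolding cring.ideal_power_Suc[OF R] cring.ideal_power_Suc[OF S] by blast
qed

context cring
begin

lemma loc_map_ring_hom_ring: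
  assumes W: "submonoid W R"
  shows "ring_hom_ring R (localization R W) (loc_map R W)"
proof -
  interpret L: cring "localization R W" by (rule localization_cring[OF W])
  show ?thesis
    by (rule ring_hom_ringI2[OF ring_axioms L.ring_axioms loc_map_hom[OF W]])
qed

text \<open>\<open>x\<close> and the image of its numerator are multiples of each other, by
  \<open>1 / s\<close> and \<open>s / 1\<close>. So an ideal of the localization is determined by
  the ring elements that map into it.\<close>

lemma localization_elem:
  assumes W: "submonoid W R" and x: "x \<in> carrier (localization R W)"
  obtains r s u v where "r \<in> carrier R" "s \<in> W" "u \<in> carrier (localization R W)"
    "v \<in> carrier (localization R W)" "x = fraction R W r s"
    "x = u \<otimes>\<^bsub>localization R W\<^esub> loc_map R W r" "loc_map R W r = v \<otimes>\<^bsub>localization R W\<^esub> x"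
proof -
  obtain r s where rs: "r \<in> carrier R" "s \<in> W" "x = fraction R W r s"
    using x by (auto simp: localization_carrier)
  have s: "s \<in> carrier R" using submonoid_carr[OF W rs(2)] .
  have one: "\<one> \<in> W" using submonoid.one_closed[OF W] .
  have "x = fraction R W \<one> s \<otimes>\<^bsub>localization R W\<^esub> loc_map R W r"
    using rs s one by (simp add: loc_map_def localization_mult[OF W])
  moreover have "loc_map R W r = fraction R W s \<one> \<otimes>\<^bsub>localization R W\<^esub> x"
  proof -
    have "fraction R W s \<one> \<otimes>\<^bsub>localization R W\<^esub> x = fraction R W (s \<otimes> r) (s \<otimes> \<one>)"
      using rs s one by (simp add: localization_mult[OF W])
    then show ?thesis using frac_expand[OF W rs(1) one rs(2)] by (simp add: loc_map_def)
  qed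
  moreover have "fraction R W \<one> s \<in> carrier (localization R W)" "fraction R W s \<one> \<in> carrier (localization R W)"
    unfolding localization_carrier using rs s one by blast+
  ultimately show ?thesis using that rs by blast
qed

text \<open>\<open>W\<close> may contain zero divisors, so the map may have a kernel. A multiplier
  from \<open>W\<close> that kills \<open>r\<close> lies outside \<open>Q\<close>, so
  \<open>r\<close> lies in \<open>Q\<close>.\<close>

lemma loc_map_eq_zero_imp:
  assumes W: "submonoid W R" and r: "r \<in> carrier R" "loc_map R W r = \<zero>\<^bsub>localization R W\<^esub>"
    and Q: "primeideal Q R" "Q \<inter> W = {}"
  shows "r \<in> Q"
proof -
  interpret Q: primeideal Q R by fact
  have "loc_map R W r = fraction R W \<zero> \<one>" using r(2) by (simp add: localization_def)
  then obtain t where t: "t \<in> W" "t \<otimes> (\<one> \<otimes> r \<ominus> \<one> \<otimes> \<zero>) = \<zero>"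
    using frac_eq_iff[OF W r(1) submonoid.one_closed[OF W] zero_closed submonoid.one_closed[OF W]]
    unfolding loc_map_def by blast
  have tc: "t \<in> carrier R" using submonoid_carr[OF W t(1)] .
  have "t \<otimes> r = \<zero>" using t(2) r(1) tc by (simp add: minus_eq)
  then have "t \<otimes> r \<in> Q" using Q.zero_closed by simp
  then show ?thesis using Q.I_prime[OF tc r(1)] Q(2) t(1) by blast
qed

lemma fraction_pow:
  assumes W: "submonoid W R" and r: "r \<in> carrier R" "s \<in> W"
  shows "s [^] (n::nat) \<in> W \<and>
    fraction R W r s [^]\<^bsub>localization R W\<^esub> n = fraction R W (r [^] n) (s [^] n)"
proof (induction n)
  case 0
  show ?case using submonoid.one_closed[OF W] by (simp add: localization_def)
next
  case (Suc n)
  then show ?case using r submonoid.m_closed[OF W] by (simp add: localization_mult[OF W])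
qed

end

section \<open>Descent of associated primes and symbolic powers to localizations\<close>

context noetherian_cring
begin

text \<open>Finitely many generators of the contraction of \<open>J\<close> generate
  \<open>J\<close>, since every element of \<open>J\<close> is a multiple of the image of its
  numerator.\<close>

lemma localization_noetherian:
  assumes W: "submonoid W R"
  shows "noetherian_ring (localization R W)"
proof -
  define L where "L = localization R W"
  define h where "h = loc_map R W"
  interpret L: cring L unfolding L_def by (rule localization_cring[OF W])
  interpret h: ring_hom_ring R L h unfolding L_def h_def by (rule loc_map_ring_hom_ring[OF W])
  have "noetherian_ring L"
  proof (rule L.noetherian_ringI)
    fix J assume J: "ideal J L"
    interpret J: ideal J L by (rule J)
    have "ideal {r \<in> carrier R. h r \<in> J} R" by (rule h.ideal_vimage[OF J])
    then obtain A where A: "A \<subseteq> carrier R" "finite A" "{r \<in> carrier R. h r \<in> J} = Idl A"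
      using finetely_gen by blast
    have hA: "h ` A \<subseteq> carrier L" using A(1) h.hom_closed by blast
    interpret G: ideal "Idl\<^bsub>L\<^esub> (h ` A)" L by (rule L.genideal_ideal[OF hA])
    have "Idl\<^bsub>L\<^esub> (h ` A) \<subseteq> J"
      using genideal_self[OF A(1)] unfolding A(3)[symmetric] by (intro L.genideal_minimal[OF J]) blast
    moreover have "J \<subseteq> Idl\<^bsub>L\<^esub> (h ` A)"
    proof
      fix x assume x: "x \<in> J"
      obtain r u v where r: "r \<in> carrier R" "u \<in> carrier L" "v \<in> carrier L"
          "x = u \<otimes>\<^bsub>L\<^esub> h r" "h r = v \<otimes>\<^bsub>L\<^esub> x"
        using localization_elem[OF W, of x] J.Icarr[OF x] unfolding L_def h_def by metis
      have "h r \<in> J" unfolding r(5) by (rule J.I_l_closed[OF x r(3)])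
      then have "r \<in> Idl A" unfolding A(3)[symmetric] using r(1) by blast
      moreover have "Idl A \<subseteq> {r \<in> carrier R. h r \<in> Idl\<^bsub>L\<^esub> (h ` A)}"
        by (rule genideal_minimal[OF h.ideal_vimage[OF G.is_ideal]])
          (use A(1) L.genideal_self[OF hA] in blast)
      ultimately have "h r \<in> Idl\<^bsub>L\<^esub> (h ` A)" by blast
      then show "x \<in> Idl\<^bsub>L\<^esub> (h ` A)" unfolding r(4) by (rule G.I_l_closed[OF _ r(2)])
    qed
    ultimately have "J = Idl\<^bsub>L\<^esub> (h ` A)" by blast
    then show "\<exists>A\<subseteq>carrier L. finite A \<and> J = Idl\<^bsub>L\<^esub> A" using hA A(2) by blast
  qed
  then show ?thesis by (simp add: L_def)
qed

text \<open>For \<open>x\<close> with numerator \<open>t0\<close> the contraction is the union of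
  the ideals \<open>colon R q (w \<otimes> t0)\<close> over \<open>w\<close> in \<open>W\<close>.
  Multiplying elements of \<open>W\<close> makes this family directed, so a maximal member is the
  whole union. Thus associated primes of the extended ideal contract to associated primes of
  \<open>q\<close>.\<close>

lemma contraction_eq_colon:
  assumes W: "submonoid W R" and q: "ideal q R" and x: "x \<in> carrier (localization R W)"
  shows "\<exists>t\<in>carrier R. {r \<in> carrier R. loc_map R W r \<in> colon (localization R W) (extension R W q) x}
    = colon R q t"
proof -
  interpret W: submonoid W R by (rule W)
  interpret h: ring_hom_ring R "localization R W" "loc_map R W" by (rule loc_map_ring_hom_ring[OF W])
  obtain t0 s0 where x': "t0 \<in> carrier R" "s0 \<in> W" "x = fraction R W t0 s0"
    using x by (auto simp: localization_carrier)
  have iff: "loc_map R W r \<in> colon (localization R W) (extension R W q) x \<longleftrightarrow> (\<exists>w\<in>W. w \<otimes> (r \<otimes> t0) \<in> q)"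
    if "r \<in> carrier R" for r
  proof -
    have "loc_map R W r \<otimes>\<^bsub>localization R W\<^esub> x = fraction R W (r \<otimes> t0) s0"
      using that x' W.one_closed W.mem_carrier by (simp add: loc_map_def localization_mult[OF W])
    then show ?thesis
      using fraction_mem_extension[OF W q m_closed[OF that x'(1)] x'(2)] h.hom_closed[OF that]
      by (simp add: colon_def)
  qed
  define C where "C = (\<lambda>w. colon R q (w \<otimes> t0)) ` W"
  obtain M where M: "M \<in> C" "\<And>I. I \<in> C \<Longrightarrow> M \<subseteq> I \<Longrightarrow> I = M"
  proof (rule exists_maximal_ideal_in[of C])
    show "C \<noteq> {}" using W.one_closed unfolding C_def by blast
    show "ideal I R" if "I \<in> C" for I
      using that x'(1) W.mem_carrier colon_ideal[OF q] by (auto simp: C_def)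
  qed blast
  then obtain w where w: "w \<in> W" "M = colon R q (w \<otimes> t0)" by (auto simp: C_def)
  have wc: "w \<in> carrier R" using w W.mem_carrier by blast
  have "{r \<in> carrier R. loc_map R W r \<in> colon (localization R W) (extension R W q) x} = colon R q (w \<otimes> t0)"
  proof (intro equalityI subsetI)
    fix r assume "r \<in> {r \<in> carrier R. loc_map R W r \<in> colon (localization R W) (extension R W q) x}"
    then obtain v where v: "r \<in> carrier R" "v \<in> W" "v \<otimes> (r \<otimes> t0) \<in> q" using iff by blast
    have vc: "v \<in> carrier R" using v W.mem_carrier by blast
    have "colon R q (w \<otimes> v \<otimes> t0) = M"
    proof (rule M(2))
      show "colon R q (w \<otimes> v \<otimes> t0) \<in> C" using W.m_closed[OF w(1) v(2)] by (auto simp: C_def)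
      have "w \<otimes> v \<otimes> t0 = w \<otimes> t0 \<otimes> v" using wc vc x'(1) by (simp add: m_ac)
      then show "M \<subseteq> colon R q (w \<otimes> v \<otimes> t0)"
        using colon_mono_mult[OF q, of "w \<otimes> t0" v] wc vc x'(1) w(2) by simp
    qed
    moreover have "r \<otimes> (w \<otimes> v \<otimes> t0) = w \<otimes> (v \<otimes> (r \<otimes> t0))"
      using v(1) wc vc x'(1) by (simp add: m_ac)
    then have "r \<in> colon R q (w \<otimes> v \<otimes> t0)"
      using ideal.I_l_closed[OF q v(3) wc] v(1) by (simp add: colon_def)
    ultimately show "r \<in> colon R q (w \<otimes> t0)" using w(2) by simp
  next
    fix r assume "r \<in> colon R q (w \<otimes> t0)"
    then have r: "r \<in> carrier R" "r \<otimes> (w \<otimes> t0) \<in> q" by (auto simp: colon_def)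
    have "w \<otimes> (r \<otimes> t0) = r \<otimes> (w \<otimes> t0)" using r(1) wc x'(1) by (simp add: m_ac)
    then have "w \<otimes> (r \<otimes> t0) \<in> q" using r(2) by simp
    then show "r \<in> {r \<in> carrier R. loc_map R W r \<in> colon (localization R W) (extension R W q) x}"
      using iff[OF r(1)] w(1) r(1) by blast
  qed
  then show ?thesis using wc x'(1) by blast
qed

text \<open>At \<open>m\<close>, the multiplier that puts \<open>x\<close> into the symbolic power
  avoids the contraction of each height one prime containing the extended ideal \<open>I\<close>.
  Hence the image of \<open>x\<close> satisfies the local conditions of
  \<open>exists_generator_of_multiple\<close>, and it lies in a principal ideal contained in the
  extension of the power \<open>a\<close> of \<open>q\<close>.\<close>

lemma symbolic_power_locally_subset:
  assumes m: "primeideal m R" and normal: "normal_domain (loc_at R m)"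
    and kill: "\<forall>x\<in>carrier (class_group (loc_at R m)).
              x [^]\<^bsub>class_group (loc_at R m)\<^esub> D = \<one>\<^bsub>class_group (loc_at R m)\<^esub>"
    and D: "D > 0" and q: "pure_height R q 1" and x: "x \<in> symbolic_power R q (D * a)"
  shows "\<exists>w\<in>carrier R - m. w \<otimes> x \<in> ideal_power R q a"
proof -
  define W where "W = carrier R - m"
  have W: "submonoid W R" unfolding W_def by (rule submonoid_compl_prime[OF m])
  interpret W: submonoid W R by (rule W)
  define S where "S = localization R W"
  have S_eq: "loc_at R m = S" by (simp add: loc_at_def S_def W_def)
  define h where "h = loc_map R W"
  interpret S: noetherian_normal_domain S
  proof -
    have "noetherian_ring S" unfolding S_def by (rule localization_noetherian[OF W])
    moreover have "cring S" unfolding S_def by (rule localization_cring[OF W])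
    moreover have "normal_domain S" using normal S_eq by simp
    moreover have "domain S" using \<open>normal_domain S\<close> by (simp add: normal_domain_def)
    ultimately show "noetherian_normal_domain S"
      by (simp add: noetherian_normal_domain_def noetherian_normal_domain_axioms_def noetherian_cring_def)
  qed
  interpret h: ring_hom_ring R S h unfolding S_def h_def by (rule loc_map_ring_hom_ring[OF W])
  have q_ideal: "ideal q R" and pure: "\<And>P. P \<in> Ass_quot R q \<Longrightarrow> height R P = 1"
    using q by (auto simp: pure_height_def)
  interpret q: ideal q R by (rule q_ideal)
  define I where "I = extension R W q"
  have I_ideal: "ideal I S" unfolding I_def S_def by (rule extension_ideal[OF W q_ideal])
  define con where "con = (\<lambda>P. {r \<in> carrier R. h r \<in> P})"
  have elem: "\<exists>r\<in>carrier R. \<exists>u\<in>carrier S. \<exists>v\<in>carrier S. y = u \<otimes>\<^bsub>S\<^esub> h r \<and> h r = v \<otimes>\<^bsub>S\<^esub> y"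
    if "y \<in> carrier S" for y
    using localization_elem[OF W that[unfolded S_def]] unfolding S_def h_def by metis
  have con_prime: "primeideal (con P) R" if "primeideal P S" for P
    unfolding con_def by (rule h.primeideal_vimage[OF is_cring that])
  have con_W: "con P \<inter> W = {}" if P: "primeideal P S" for P
  proof -
    interpret P: primeideal P S by (rule P)
    have False if r: "r \<in> W" "h r \<in> P" for r
    proof -
      have rc: "r \<in> carrier R" using r(1) W.mem_carrier by blast
      have "fraction R W \<one> r \<in> carrier S" unfolding S_def localization_carrier using r(1) by blast
      then have "fraction R W \<one> r \<otimes>\<^bsub>S\<^esub> h r \<in> P" by (rule P.I_l_closed[OF r(2)])
      also have "fraction R W \<one> r \<otimes>\<^bsub>S\<^esub> h r = fraction R W (r \<otimes> \<one>) (r \<otimes> \<one>)"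
        using r(1) rc W.one_closed by (simp add: S_def h_def loc_map_def localization_mult[OF W])
      also have "\<dots> = h \<one>"
        using frac_expand[OF W one_closed W.one_closed r(1)] by (simp add: h_def loc_map_def)
      finally have "\<one>\<^bsub>S\<^esub> \<in> P" by simp
      then show False using S.primeideal_one_notin[OF P] by simp
    qed
    then show ?thesis by (auto simp: con_def)
  qed
  have con_strict: "con P \<subset> con Q" if P: "primeideal P S" and Q: "primeideal Q S" and PQ: "P \<subset> Q" for P Q
  proof -
    interpret P: primeideal P S by (rule P)
    interpret Q: primeideal Q S by (rule Q)
    obtain y where y: "y \<in> Q" "y \<notin> P" using PQ by blast
    obtain r u v where r: "r \<in> carrier R" "u \<in> carrier S" "v \<in> carrier S" "y = u \<otimes>\<^bsub>S\<^esub> h r" "h r = v \<otimes>\<^bsub>S\<^esub> y"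
      using elem[OF Q.Icarr[OF y(1)]] by blast
    have "h r \<in> Q" unfolding r(5) by (rule Q.I_l_closed[OF y(1) r(3)])
    moreover have "h r \<notin> P"
    proof
      assume "h r \<in> P"
      then have "y \<in> P" unfolding r(4) by (rule P.I_l_closed[OF _ r(2)])
      with y(2) show False by simp
    qed
    ultimately show ?thesis using r(1) PQ by (auto simp: con_def)
  qed
  have kernel: "con {\<zero>\<^bsub>S\<^esub>} \<subseteq> Q" if "primeideal Q R" "Q \<inter> W = {}" for Q
    using loc_map_eq_zero_imp[OF W _ _ that] unfolding con_def h_def S_def by blast
  have con_Ass: "con P \<in> Ass_quot R q" if "primeideal P S" "t \<in> carrier S" "P = colon S I t" for P t
    using contraction_eq_colon[OF W q_ideal that(2)[unfolded S_def]] con_prime[OF that(1)]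
    unfolding Ass_quot_iff[OF q_ideal] con_def that(3) I_def S_def h_def by blast
  have pure_S: "P \<in> height_one_primes S" if P: "primeideal P S" "t \<in> carrier S" "P = colon S I t" for P t
  proof -
    have ht: "height R (con P) = 1" by (rule pure[OF con_Ass[OF P]])
    interpret P: primeideal P S by (rule P(1))
    have "height S P = 1"
    proof (rule S.height_oneI[OF P(1) S.zeroprimeideal])
      \<comment> \<open>A prime strictly below \<open>con P\<close> misses \<open>W\<close> and
        therefore contains the kernel of \<open>h\<close>. So \<open>con P\<close> is larger than
        the kernel, and \<open>P\<close> is not zero.\<close>
      obtain Q where Q: "primeideal Q R" "Q \<subset> con P"
        using height_gt_0_imp_smaller_prime[of "con P"] ht by auto
      then have "con {\<zero>\<^bsub>S\<^esub>} \<subseteq> Q" using kernel con_W[OF P(1)] by blast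
      then have "P \<noteq> {\<zero>\<^bsub>S\<^esub>}" using Q(2) by blast
      then show "{\<zero>\<^bsub>S\<^esub>} \<subset> P" by (rule S.zero_psubset_ideal[OF P.is_ideal])
      fix Q Q' assume Q: "primeideal Q S" "primeideal Q' S" "Q' \<subset> Q" "Q \<subset> P"
      show False
        by (rule height_one_no_chain[OF ht con_prime[OF P(1)] con_prime[OF Q(1)] con_prime[OF Q(2)]
              con_strict[OF Q(2,1,3)] con_strict[OF Q(1) P(1) Q(4)]])
    qed
    with P(1) show ?thesis by (simp add: height_one_primes_def)
  qed
  have hq: "h ` q \<subseteq> I"
    unfolding h_def loc_map_def I_def extension_def using W.one_closed by blast
  have "I \<noteq> {\<zero>\<^bsub>S\<^esub>}"
  proof
    assume I0: "I = {\<zero>\<^bsub>S\<^esub>}"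
    \<comment> \<open>\<open>K\<close> is the kernel of \<open>h\<close>, a prime contained in every
      prime that misses \<open>W\<close>. If \<open>q\<close> vanished in \<open>S\<close>, some
      associated prime of \<open>q\<close> would lie inside \<open>K\<close>; having height one, it
      has a prime strictly below it, and that prime would again contain \<open>K\<close>.\<close>
    define K where "K = con {\<zero>\<^bsub>S\<^esub>}"
    have K: "primeideal K R" unfolding K_def by (rule con_prime[OF S.zeroprimeideal])
    have "q \<subseteq> K" using hq q.Icarr unfolding I0 K_def con_def by blast
    then have "colon R q \<one> \<inter> (carrier R - K) = {}" by (auto simp: colon_def)
    then obtain t where t: "t \<in> carrier R" "primeideal (colon R q (\<one> \<otimes> t)) R"
        "colon R q (\<one> \<otimes> t) \<inter> (carrier R - K) = {}"
      using exists_prime_colon[OF q_ideal one_closed submonoid_compl_prime[OF K]] by blast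
    have "colon R q t \<in> Ass_quot R q" unfolding Ass_quot_iff[OF q_ideal] using t by auto
    then have "height R (colon R q t) > 0" using pure by simp
    then obtain Q where Q: "primeideal Q R" "Q \<subset> colon R q t"
      using height_gt_0_imp_smaller_prime by blast
    have "colon R q t \<subseteq> K" using t(1,3) by (auto simp: colon_def)
    then have "Q \<inter> W = {}" using Q(2) con_W[OF S.zeroprimeideal] unfolding K_def by blast
    then have "K \<subseteq> Q" unfolding K_def by (rule kernel[OF Q(1)])
    with Q(2) \<open>colon R q t \<subseteq> K\<close> show False by blast
  qed
  \<comment> \<open>The element called \<open>h\<close> in the overview is \<open>g\<close> here, as
    \<open>h\<close> denotes the map to \<open>S\<close>.\<close>
  from S.exists_generator_of_multiple[OF D kill[unfolded S_eq] I_ideal this pure_S]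
  obtain g where g: "g \<in> I" and gen: "\<forall>y\<in>carrier S. \<forall>n.
    (\<forall>P\<in>height_one_primes S. I \<subseteq> P \<longrightarrow> (\<forall>e\<in>I. I \<subseteq> saturation S P (PIdl\<^bsub>S\<^esub> e) \<longrightarrow>
        y \<in> saturation S P (PIdl\<^bsub>S\<^esub> (e [^]\<^bsub>S\<^esub> (D * n))))) \<longrightarrow> y \<in> PIdl\<^bsub>S\<^esub> (g [^]\<^bsub>S\<^esub> n)"
    by (rule bexE)
  obtain w where w: "w \<in> carrier R" "w \<notin> \<Union> (Ass_quot R q)" "w \<otimes> x \<in> ideal_power R q (D * a)"
    and xc: "x \<in> carrier R"
    using x unfolding symbolic_power_eq[OF q_ideal] by blast
  have "h x \<in> PIdl\<^bsub>S\<^esub> (g [^]\<^bsub>S\<^esub> a)"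
  proof (rule gen[rule_format])
    show "h x \<in> carrier S" using xc by simp
    fix P e assume P: "P \<in> height_one_primes S" "I \<subseteq> P" and e: "e \<in> I" "I \<subseteq> saturation S P (PIdl\<^bsub>S\<^esub> e)"
    have prime: "primeideal P S" using P(1) by (simp add: height_one_primes_def)
    obtain t where t: "t \<in> carrier S" "P = colon S I t"
      using S.height_one_eq_colon[OF P(1) I_ideal \<open>I \<noteq> {\<zero>\<^bsub>S\<^esub>}\<close> P(2)] .
    \<comment> \<open>Every height one prime containing \<open>I\<close> is associated to
      \<open>I\<close>, so it contracts to an associated prime of \<open>q\<close>, which
      \<open>w\<close> avoids.\<close>
    have "w \<notin> con P" using con_Ass[OF prime t] w(2) by blast
    then have hw: "h w \<in> carrier S - P" using w(1) by (auto simp: con_def)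
    have ec: "e \<in> carrier S" using ideal.Icarr[OF I_ideal e(1)] .
    have "h (w \<otimes> x) \<in> ideal_power S I (D * a)"
      using h.image_ideal_power[OF is_cring S.is_cring q_ideal hq] w(3) by blast
    then have "h (w \<otimes> x) \<in> saturation S P (PIdl\<^bsub>S\<^esub> (e [^]\<^bsub>S\<^esub> (D * a)))"
      using S.ideal_power_subset_saturation[OF prime I_ideal ec e(2)] by blast
    then have "h w \<otimes>\<^bsub>S\<^esub> h x \<in> saturation S P (PIdl\<^bsub>S\<^esub> (e [^]\<^bsub>S\<^esub> (D * a)))" using w(1) xc by simp
    then show "h x \<in> saturation S P (PIdl\<^bsub>S\<^esub> (e [^]\<^bsub>S\<^esub> (D * a)))"
      by (rule S.mem_saturation_saturation[OF prime h.hom_closed[OF xc] hw])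
  qed
  moreover have "g [^]\<^bsub>S\<^esub> a \<in> extension R W (ideal_power R q a)"
  proof -
    obtain r s where g': "r \<in> q" "s \<in> W" "g = fraction R W r s"
      using g unfolding I_def extension_def by blast
    show ?thesis
      using fraction_pow[OF W q.Icarr[OF g'(1)] g'(2), of a] pow_mem_ideal_power[OF q_ideal g'(1), of a]
      unfolding g'(3) S_def extension_def by blast
  qed
  then have "PIdl\<^bsub>S\<^esub> (g [^]\<^bsub>S\<^esub> a) \<subseteq> extension R W (ideal_power R q a)"
    by (rule S.cgenideal_minimal[OF extension_ideal[OF W ideal_power_ideal[OF q_ideal], folded S_def]])
  ultimately have "fraction R W x \<one> \<in> extension R W (ideal_power R q a)"
    unfolding h_def loc_map_def by blast
  then have "\<exists>w\<in>W. w \<otimes> x \<in> ideal_power R q a"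
    unfolding fraction_mem_extension[OF W ideal_power_ideal[OF q_ideal] xc W.one_closed] .
  then show ?thesis unfolding W_def .
qed

section \<open>From maximal ideals back to the ring\<close>

lemma exists_maximalideal_superset:
  assumes J: "ideal J R" "J \<noteq> carrier R"
  obtains m where "maximalideal m R" "J \<subseteq> m"
proof -
  define C where "C = {I. ideal I R \<and> J \<subseteq> I \<and> I \<noteq> carrier R}"
  obtain m where m: "m \<in> C" "\<And>I. I \<in> C \<Longrightarrow> m \<subseteq> I \<Longrightarrow> I = m"
    by (rule exists_maximal_ideal_in[of C]) (use J in \<open>auto simp: C_def\<close>)
  have "maximalideal m R"
  proof (rule maximalidealI)
    show "ideal m R" "carrier R \<noteq> m" using m(1) by (auto simp: C_def)
    show "I = m \<or> I = carrier R" if "ideal I R" "m \<subseteq> I" for I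
      using m(2)[of I] m(1) that by (auto simp: C_def)
  qed
  with that m(1) show ?thesis by (auto simp: C_def)
qed

end

theorem lemma2p6:
  fixes R :: "('a, 'b) ring_scheme" and D a :: nat and q :: "'a set"
  assumes "cring R" and "noetherian_ring R" and "reduced_ring R" and "normal_ring R"
    and "D > 0"
    and "\<And>m. maximalideal m R \<Longrightarrow>
           (\<forall>x\<in>carrier (class_group (loc_at R m)).
              x [^]\<^bsub>class_group (loc_at R m)\<^esub> D = \<one>\<^bsub>class_group (loc_at R m)\<^esub>)"
    and "a > 0"
    and "pure_height R q 1"
  shows "symbolic_power R q (D * a) \<subseteq> ideal_power R q a"
proof
  interpret noetherian_cring R using assms(1,2) by (simp add: noetherian_cring_def)
  fix x assume x: "x \<in> symbolic_power R q (D * a)"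
  have q: "ideal q R" using assms(8) by (simp add: pure_height_def)
  have xc: "x \<in> carrier R" using x unfolding symbolic_power_eq[OF q] by blast
  have J: "ideal (colon R (ideal_power R q a) x) R"
    by (rule colon_ideal[OF ideal_power_ideal[OF q] xc])
  \<comment> \<open>This ideal collects the multipliers that take \<open>x\<close> into the power of
    \<open>q\<close>. At each maximal ideal the local statement supplies one outside that ideal, so
    it is the unit ideal and the unit itself is a multiplier.\<close>
  have "colon R (ideal_power R q a) x = carrier R"
  proof (rule ccontr)
    assume "colon R (ideal_power R q a) x \<noteq> carrier R"
    then obtain m where m: "maximalideal m R" "colon R (ideal_power R q a) x \<subseteq> m"
      using exists_maximalideal_superset[OF J] by blast
    have prime: "primeideal m R" by (rule maximalideal_prime[OF m(1)])
    then have "normal_domain (loc_at R m)" using assms(4) by (simp add: normal_ring_def)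
    then obtain w where "w \<in> carrier R - m" "w \<otimes>\<^bsub>R\<^esub> x \<in> ideal_power R q a"
      using symbolic_power_locally_subset[OF prime _ assms(6)[OF m(1)] assms(5,8) x] by blast
    with m(2) show False by (auto simp: colon_def)
  qed
  then have "\<one>\<^bsub>R\<^esub> \<in> colon R (ideal_power R q a) x" by simp
  then show "x \<in> ideal_power R q a" using xc by (simp add: colon_def)
qed

end
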